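(* Let $F:\mathcal{L}^2(\Omega,\mathscr{F},R^n)\to\mathcal{L}^2(\Omega,\mathscr{F},R^n)$ be monotone and Lipschitz continuous with constant $L_F>0$ (with respect to $\|\cdot\|_{\mathcal{L}^2}$), and assume that the solution set of the variational inequality $\mathrm{VI}(T,\mathcal{K})$ is nonempty. Let $\beta>0$, $r>\frac{L_F}{\beta}+1$ and $\alpha\in(0,1)$. Let $\{\theta^k\}_{k=0}^\infty=\{(x^k,y^k,\lambda^k)^\top\}_{k=0}^\infty$ be the sequence generated by the prediction-correction ADMM from any starting point $\theta^0\in\mathcal{C}\times\mathcal{N}\times\mathcal{L}^2(\Omega,\mathscr{F},R^n)$. Then the sequence $\{x^k\}_{k=0}^\infty$ converges weakly in $\mathcal{L}^2(\Omega,\mathscr{F},R^n)$ to a solution $x^*$ of the multistage stochastic variational inequality $\mathrm{MSVI}(F,\mathcal{C}\cap\mathcal{N})$, i.e. to some $x^*\in\mathcal{C}\cap\mathcal{N}$ with $-F(x^* )\in N_{\mathcal{C}\cap\mathcal{N}}(x^* )$.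
   Context: Let $(\Omega,\mathscr{F},P)$ be a complete probability space and let $\mathcal{L}^2(\Omega,\mathscr{F},R^n)$ be the Hilbert space of (a.s. equivalence classes of) square-integrable $\mathscr{F}$-measurable $R^n$-valued random vectors with inner product $\langle\xi,\eta\rangle_{\mathcal{L}^2}=\mathbb{E}\langle\xi,\eta\rangle$ and norm $\|\xi\|_{\mathcal{L}^2}$. Let $N\in\mathbb{N}$, let $\xi_j$ be $\mathscr{F}$-measurable $R^{m_j}$-valued random vectors ($j=1,\dots,N-1$), put $\mathscr{F}_0=\{\emptyset,\Omega\}$ and, for $1\le i\le N-1$, let $\mathscr{F}_i$ be the $\sigma$-field generated by $\xi_1,\dots,\xi_i$ together with all $P$-null sets. Let $n_0+\cdots+n_{N-1}=n$ with $n_i\in\mathbb{N}$, and write $x=(x_0,\dots,x_{N-1})$ with $x_i$ valued in $R^{n_i}$. The nonanticipativity subspace is $\mathcal{N}=\{x\in\mathcal{L}^2(\Omega,\mathscr{F},R^n): x_i \text{ is } \mathscr{F}_i\text{-measurable},\ i=0,\dots,N-1\}$, a closed linear subspace. Let $C_i:\Omega\rightsquigarrow R^{n_i}$ be $\mathscr{F}_i$-measurable set-valued maps with nonempty closed convex values, $i=0,\dots,N-1$ (measurable means $\{\omega: C_i(\omega)\cap A\ne\emptyset\}\in\mathscr{F}_i$ for every Borel $A\subset R^{n_i}$), and let $\mathcal{C}=\{x\in\mathcal{L}^2(\Omega,\mathscr{F},R^n): x_i(\omega)\in C_i(\omega)\text{ for a.s. }\omega\in\Omega,\ i=0,\dots,N-1\}$,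 a closed convex set. For a nonempty closed convex $\mathcal{S}\subset\mathcal{L}^2(\Omega,\mathscr{F},R^n)$ and $x\in\mathcal{S}$, $N_{\mathcal{S}}(x)=\{v: \langle v,y-x\rangle_{\mathcal{L}^2}\le0\ \forall y\in\mathcal{S}\}$ is the normal cone, and $\Pi_{\mathcal{S}}$ denotes the metric projection onto $\mathcal{S}$. Let $\mathcal{K}=\mathcal{C}\times\mathcal{N}\times\mathcal{L}^2(\Omega,\mathscr{F},R^n)$ and, for $\theta=(x,y,\lambda)^\top\in[\mathcal{L}^2(\Omega,\mathscr{F},R^n)]^3$, let $T(\theta)=(F(x)-\lambda,\ \lambda,\ x-y)^\top$. $\mathrm{VI}(T,\mathcal{K})$ is the problem of finding $\theta^*\in\mathcal{K}$ such that $\langle T(\theta^* ),\theta-\theta^*\rangle_{\mathcal{L}^2}\ge 0$ for all $\theta\in\mathcal{K}$ (inner product on the product space, i.e. the sum of the componentwise inner products). $F$ is monotone if $\langle F(x)-F(y),x-y\rangle_{\mathcal{L}^2}\ge0$ for all $x,y$. Prediction-correction ADMM. Given $\beta,r>0$ with $r>\frac{L_F}{\beta}+1$, $\alpha\in(0,1)$ and $\theta^0=(x^0,y^0,\lambda^0)^\top\in\mathcal{C}\times\mathcal{N}\times\mathcal{L}^2(\Omega,\mathscr{F},R^n)$, for $k=0,1,2,\dots$ and $\theta^k=(x^k,y^k,\lambda^k)^\top$ compute the prediction $\tilde\theta^k=(\tilde x^k,\tilde y^k,\tilde\lambda^k)^\top$ by $$\tilde x^k=\Pi_{\mathcal{C}}\{x^k-\tfrac{1}{\beta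 r}[F(x^k)-\lambda^k+\beta(x^k-y^k)]\},$$ $$\tilde y^k=\Pi_{\mathcal{N}}\{y^k-\tfrac1\beta[\lambda^k-\beta(\tilde x^k-y^k)]\},\qquad \tilde\lambda^k=\lambda^k-\beta(\tilde x^k-\tilde y^k),$$ and then the correction $\theta^{k+1}=\theta^k-\alpha\, d(\theta^k,\tilde\theta^k,\zeta^k)$, where $\zeta^k=(\zeta_x^k,0,0)^\top$, $\zeta_x^k=F(x^k)-F(\tilde x^k)+\beta(x^k-\tilde x^k)$, $d(\theta^k,\tilde\theta^k,\zeta^k)=\theta^k-\tilde\theta^k-G^{-1}\zeta^k$, and $G(x,y,\lambda)^\top=(\beta r x,\ \beta y,\ \tfrac1\beta\lambda)^\top$ (so $G^{-1}(u,v,w)^\top=(\tfrac{1}{\beta r}u,\tfrac1\beta v,\beta w)^\top$). *)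

theory Defs
  imports "HOL-Probability.Probability"
begin

text \<open>
  An element of the Hilbert space of square-integrable random vectors is an almost-sure equivalence
  class; it is given here by a representative, a function in the carrier \<open>L2 M\<close>. The sets and maps
  below are invariant under a.s. equality, and \<open>L2_norm M\<close> vanishes exactly on the representatives
  of zero.
\<close>

definition L2 :: "'w measure \<Rightarrow> ('w \<Rightarrow> real^'n) set" where
  "L2 M = {x \<in> borel_measurable M. integrable M (\<lambda>\<omega>. (norm (x \<omega>))\<^sup>2)}"

definition L2_inner :: "'w measure \<Rightarrow> ('w \<Rightarrow> real^'n) \<Rightarrow> ('w \<Rightarrow> real^'n) \<Rightarrow> real" where
  "L2_inner M x y = (\<integral>\<omega>. x \<omega> \<bullet> y \<omega> \<partial>M)"

definition L2_norm :: "'w measure \<Rightarrow> ('w \<Rightarrow> real^'n) \<Rightarrow> real" where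
  "L2_norm M x = sqrt (L2_inner M x x)"

definition L2_weakly_converges ::
    "'w measure \<Rightarrow> (nat \<Rightarrow> 'w \<Rightarrow> real^'n) \<Rightarrow> ('w \<Rightarrow> real^'n) \<Rightarrow> bool" where
  "L2_weakly_converges M X x \<longleftrightarrow>
     (\<forall>k. X k \<in> L2 M) \<and> x \<in> L2 M \<and>
     (\<forall>v\<in>L2 M. (\<lambda>k. L2_inner M (X k) v) \<longlonglongrightarrow> L2_inner M x v)"

text \<open>The second clause says that the map is well defined on equivalence classes.\<close>

definition L2_operator :: "'w measure \<Rightarrow> (('w \<Rightarrow> real^'n) \<Rightarrow> ('w \<Rightarrow> real^'n)) \<Rightarrow> bool" where
  "L2_operator M F \<longleftrightarrow>
     (\<forall>x\<in>L2 M. F x \<in> L2 M) \<and>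
     (\<forall>x\<in>L2 M. \<forall>y\<in>L2 M. (AE \<omega> in M. x \<omega> = y \<omega>) \<longrightarrow> (AE \<omega> in M. F x \<omega> = F y \<omega>))"

definition L2_monotone :: "'w measure \<Rightarrow> (('w \<Rightarrow> real^'n) \<Rightarrow> ('w \<Rightarrow> real^'n)) \<Rightarrow> bool" where
  "L2_monotone M F \<longleftrightarrow>
     (\<forall>x\<in>L2 M. \<forall>y\<in>L2 M. L2_inner M (\<lambda>\<omega>. F x \<omega> - F y \<omega>) (\<lambda>\<omega>. x \<omega> - y \<omega>) \<ge> 0)"

definition L2_lipschitz ::
    "'w measure \<Rightarrow> real \<Rightarrow> (('w \<Rightarrow> real^'n) \<Rightarrow> ('w \<Rightarrow> real^'n)) \<Rightarrow> bool" where
  "L2_lipschitz M L F \<longleftrightarrow>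
     (\<forall>x\<in>L2 M. \<forall>y\<in>L2 M.
        L2_norm M (\<lambda>\<omega>. F x \<omega> - F y \<omega>) \<le> L * L2_norm M (\<lambda>\<omega>. x \<omega> - y \<omega>))"

text \<open>
  Metric projection, following the library's \<open>closest_point\<close>; it picks one representative of the
  a.s. unique nearest element of a nonempty closed convex set.
\<close>

definition L2_proj ::
    "'w measure \<Rightarrow> ('w \<Rightarrow> real^'n) set \<Rightarrow> ('w \<Rightarrow> real^'n) \<Rightarrow> ('w \<Rightarrow> real^'n)" where
  "L2_proj M S z = (SOME p. p \<in> S \<and>
     (\<forall>y\<in>S. L2_norm M (\<lambda>\<omega>. z \<omega> - p \<omega>) \<le> L2_norm M (\<lambda>\<omega>. z \<omega> - y \<omega>)))"

definition L2_normal_cone ::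
    "'w measure \<Rightarrow> ('w \<Rightarrow> real^'n) set \<Rightarrow> ('w \<Rightarrow> real^'n) \<Rightarrow> ('w \<Rightarrow> real^'n) set" where
  "L2_normal_cone M S x = {v \<in> L2 M. \<forall>y\<in>S. L2_inner M v (\<lambda>\<omega>. y \<omega> - x \<omega>) \<le> 0}"

definition MSVI_solution ::
    "'w measure \<Rightarrow> (('w \<Rightarrow> real^'n) \<Rightarrow> ('w \<Rightarrow> real^'n)) \<Rightarrow> ('w \<Rightarrow> real^'n) set
      \<Rightarrow> ('w \<Rightarrow> real^'n) \<Rightarrow> bool" where
  "MSVI_solution M F S x \<longleftrightarrow> x \<in> S \<and> (\<lambda>\<omega>. - F x \<omega>) \<in> L2_normal_cone M S x"


text \<open>
  The decomposition of \<open>R^n\<close> into \<open>R^(n_0) \<times> ... \<times> R^(n_(N-1))\<close> is given by a map \<open>stage\<close> that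
  assigns to each coordinate the index of its block, so \<open>n_i = card {j. stage j = i}\<close>.
  The block \<open>R^(n_i)\<close> is identified with the coordinate subspace \<open>block_space stage i\<close>, whose Borel
  sets are the Borel sets of \<open>R^n\<close> contained in it, and \<open>x_i\<close> with \<open>block stage i x\<close>.
\<close>

definition block_space :: "('n::finite \<Rightarrow> nat) \<Rightarrow> nat \<Rightarrow> (real^'n) set" where
  "block_space stage i = {v. \<forall>j. stage j \<noteq> i \<longrightarrow> v $ j = 0}"

definition block :: "('n::finite \<Rightarrow> nat) \<Rightarrow> nat \<Rightarrow> real^'n \<Rightarrow> real^'n" where
  "block stage i v = (\<chi> j. if stage j = i then v $ j else 0)"

text \<open>
  The random vector \<open>\<xi> j\<close> has values in \<open>R^(m j)\<close>, rendered as the product space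
  \<open>\<Pi>\<^sub>M l\<in>{..<m j}. borel\<close> because the dimension varies with \<open>j\<close>.
\<close>

definition info_algebra ::
    "'w measure \<Rightarrow> (nat \<Rightarrow> nat) \<Rightarrow> (nat \<Rightarrow> 'w \<Rightarrow> nat \<Rightarrow> real) \<Rightarrow> nat \<Rightarrow> 'w measure" where
  "info_algebra M m \<xi> i =
     (if i = 0 then sigma (space M) {}
      else sigma (space M)
        ({\<xi> j -` A \<inter> space M | j A. j \<in> {1..i} \<and> A \<in> sets (\<Pi>\<^sub>M l\<in>{..<m j}. (borel :: real measure))}
          \<union> null_sets M))"

text \<open>
  An equivalence class is measurable for a sub-sigma-field if it has a measurable representative.
  This matters at stage 0, whose sigma-field does not contain the null sets.
\<close>

definition nonanticipative ::
    "'w measure \<Rightarrow> nat \<Rightarrow> (nat \<Rightarrow> nat) \<Rightarrow> (nat \<Rightarrow> 'w \<Rightarrow> nat \<Rightarrow> real) \<Rightarrow> ('n::finite \<Rightarrow> nat)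
      \<Rightarrow> ('w \<Rightarrow> real^'n) set" where
  "nonanticipative M N m \<xi> stage =
     {x \<in> L2 M. \<forall>i<N. \<exists>g \<in> borel_measurable (info_algebra M m \<xi> i).
        AE \<omega> in M. block stage i (x \<omega>) = g \<omega>}"

definition measurable_set_valued ::
    "'w measure \<Rightarrow> 'a::topological_space set \<Rightarrow> ('w \<Rightarrow> 'a set) \<Rightarrow> bool" where
  "measurable_set_valued M B \<Gamma> \<longleftrightarrow>
     (\<forall>A \<in> sets borel. A \<subseteq> B \<longrightarrow> {\<omega> \<in> space M. \<Gamma> \<omega> \<inter> A \<noteq> {}} \<in> sets M)"

definition constraint_set ::
    "'w measure \<Rightarrow> nat \<Rightarrow> ('n::finite \<Rightarrow> nat) \<Rightarrow> (nat \<Rightarrow> 'w \<Rightarrow> (real^'n) set)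
      \<Rightarrow> ('w \<Rightarrow> real^'n) set" where
  "constraint_set M N stage C =
     {x \<in> L2 M. \<forall>i<N. AE \<omega> in M. block stage i (x \<omega>) \<in> C i \<omega>}"


type_synonym ('w, 'n) triple =
  "('w \<Rightarrow> real^'n) \<times> ('w \<Rightarrow> real^'n) \<times> ('w \<Rightarrow> real^'n)"

definition triple_diff :: "('w, 'n::finite) triple \<Rightarrow> ('w, 'n) triple \<Rightarrow> ('w, 'n) triple" where
  "triple_diff = (\<lambda>(x, y, l) (x', y', l').
     (\<lambda>\<omega>. x \<omega> - x' \<omega>, \<lambda>\<omega>. y \<omega> - y' \<omega>, \<lambda>\<omega>. l \<omega> - l' \<omega>))"

definition triple_scale :: "real \<Rightarrow> ('w, 'n::finite) triple \<Rightarrow> ('w, 'n) triple" where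
  "triple_scale a = (\<lambda>(x, y, l). (\<lambda>\<omega>. a *\<^sub>R x \<omega>, \<lambda>\<omega>. a *\<^sub>R y \<omega>, \<lambda>\<omega>. a *\<^sub>R l \<omega>))"

definition triple_inner ::
    "'w measure \<Rightarrow> ('w, 'n::finite) triple \<Rightarrow> ('w, 'n) triple \<Rightarrow> real" where
  "triple_inner M = (\<lambda>(x, y, l) (x', y', l').
     L2_inner M x x' + L2_inner M y y' + L2_inner M l l')"

definition VI_solution ::
    "'w measure \<Rightarrow> (('w, 'n::finite) triple \<Rightarrow> ('w, 'n) triple) \<Rightarrow> ('w, 'n) triple set
      \<Rightarrow> ('w, 'n) triple \<Rightarrow> bool" where
  "VI_solution M T K \<theta>' \<longleftrightarrow>
     \<theta>' \<in> K \<and> (\<forall>\<theta>\<in>K. triple_inner M (T \<theta>') (triple_diff \<theta> \<theta>') \<ge> 0)"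

definition T_op ::
    "(('w \<Rightarrow> real^'n) \<Rightarrow> ('w \<Rightarrow> real^'n)) \<Rightarrow> ('w, 'n::finite) triple \<Rightarrow> ('w, 'n) triple" where
  "T_op F = (\<lambda>(x, y, l). (\<lambda>\<omega>. F x \<omega> - l \<omega>, l, \<lambda>\<omega>. x \<omega> - y \<omega>))"

definition G_inv :: "real \<Rightarrow> real \<Rightarrow> ('w, 'n::finite) triple \<Rightarrow> ('w, 'n) triple" where
  "G_inv \<beta> r = (\<lambda>(u, v, w).
     (\<lambda>\<omega>. (1 / (\<beta> * r)) *\<^sub>R u \<omega>, \<lambda>\<omega>. (1 / \<beta>) *\<^sub>R v \<omega>, \<lambda>\<omega>. \<beta> *\<^sub>R w \<omega>))"

definition admm_predict ::
    "'w measure \<Rightarrow> ('w \<Rightarrow> real^'n::finite) set \<Rightarrow> ('w \<Rightarrow> real^'n) set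
      \<Rightarrow> (('w \<Rightarrow> real^'n) \<Rightarrow> ('w \<Rightarrow> real^'n)) \<Rightarrow> real \<Rightarrow> real
      \<Rightarrow> ('w, 'n) triple \<Rightarrow> ('w, 'n) triple" where
  "admm_predict M \<C> \<N> F \<beta> r = (\<lambda>(x, y, l).
     let xt = L2_proj M \<C>
           (\<lambda>\<omega>. x \<omega> - (1 / (\<beta> * r)) *\<^sub>R (F x \<omega> - l \<omega> + \<beta> *\<^sub>R (x \<omega> - y \<omega>)));
         yt = L2_proj M \<N> (\<lambda>\<omega>. y \<omega> - (1 / \<beta>) *\<^sub>R (l \<omega> - \<beta> *\<^sub>R (xt \<omega> - y \<omega>)));
         lt = (\<lambda>\<omega>. l \<omega> - \<beta> *\<^sub>R (xt \<omega> - yt \<omega>))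
     in (xt, yt, lt))"

definition admm_zeta ::
    "(('w \<Rightarrow> real^'n) \<Rightarrow> ('w \<Rightarrow> real^'n)) \<Rightarrow> real
      \<Rightarrow> ('w, 'n::finite) triple \<Rightarrow> ('w, 'n) triple \<Rightarrow> ('w, 'n) triple" where
  "admm_zeta F \<beta> = (\<lambda>(x, y, l) (xt, yt, lt).
     (\<lambda>\<omega>. F x \<omega> - F xt \<omega> + \<beta> *\<^sub>R (x \<omega> - xt \<omega>), \<lambda>\<omega>. 0, \<lambda>\<omega>. 0))"

definition admm_direction ::
    "real \<Rightarrow> real \<Rightarrow> ('w, 'n::finite) triple \<Rightarrow> ('w, 'n) triple \<Rightarrow> ('w, 'n) triple
      \<Rightarrow> ('w, 'n) triple" where
  "admm_direction \<beta> r \<theta> \<theta>t \<zeta> = triple_diff (triple_diff \<theta> \<theta>t) (G_inv \<beta> r \<zeta>)"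

definition admm_step ::
    "'w measure \<Rightarrow> ('w \<Rightarrow> real^'n::finite) set \<Rightarrow> ('w \<Rightarrow> real^'n) set
      \<Rightarrow> (('w \<Rightarrow> real^'n) \<Rightarrow> ('w \<Rightarrow> real^'n)) \<Rightarrow> real \<Rightarrow> real \<Rightarrow> real
      \<Rightarrow> ('w, 'n) triple \<Rightarrow> ('w, 'n) triple" where
  "admm_step M \<C> \<N> F \<beta> r \<alpha> \<theta> =
     (let \<theta>t = admm_predict M \<C> \<N> F \<beta> r \<theta>
      in triple_diff \<theta> (triple_scale \<alpha> (admm_direction \<beta> r \<theta> \<theta>t (admm_zeta F \<beta> \<theta> \<theta>t))))"

end

theory Submission
  imports Defs "HOL-Library.Function_Algebras"
begin

text \<open>
  In the norm weighted by \<open>(\<beta> r, \<beta>, 1/\<beta>)\<close> the iteration is quasi-Fejer monotone with respect to the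
  solutions of the variational inequality. The predicted multiplier is orthogonal to the
  nonanticipativity space, and the correction relaxes towards it, so on that space the multiplier
  decays like \<open>(1 - \<alpha>)^k\<close>. Hence the cross term between the changes of \<open>y\<close> and \<open>\<lambda>\<close>, which has no sign
  for an arbitrary initial multiplier, only contributes a summable error. It follows that iterates
  and predictions become asymptotically equal, that weak cluster points are solutions by Minty's
  lemma, and that the weak cluster point is unique by Opial's argument.
\<close>

section \<open>Complete semi-inner product spaces\<close>

text \<open>Vectors are representatives of a.s. classes, so the inner product is only semidefinite:
  limits and projections are unique up to null vectors, and closed sets are saturated under null
  differences.

  The bound on \<open>r\<close> says that \<open>\<beta> * r\<close> exceeds
  \<open>L + \<beta>\<close>, a Lipschitz constant of F + \<beta> id. The error
  \<open>\<zeta>\<close> is then dominated by the proximal term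
  \<open>(\<beta> * r) *\<^sub>R (x k - xt k)\<close>, which keeps the corrected step for
  \<open>x\<close> a descent step for every \<alpha> below 1.

  The cross term appears because the x-prediction uses the old \<open>y k\<close> while the
  predicted multiplier uses \<open>yt k\<close>; the two are linked by \<open>xt k - yt k\<close>,
  which is the multiplier change divided by \<beta>.

  Two products of weakly convergent sequences obstruct the passage to the limit. The pairing of F at
  \<open>xt k\<close> with \<open>xt k\<close> is removed by monotonicity, which moves F to a fixed
  test point. The pairing of \<open>lt k\<close> with \<open>xt k\<close> tends to 0, because
  \<open>lt k\<close> is orthogonal to \<open>yt k\<close> and \<open>xt k - yt k\<close> vanishes
  in norm.\<close>

locale semi_hilbert =
  fixes ip :: "'a::real_vector \<Rightarrow> 'a \<Rightarrow> real"  (infixl "\<odot>" 70)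
  assumes ip_commute: "x \<odot> y = y \<odot> x"
    and ip_add_left: "(x + y) \<odot> z = x \<odot> z + y \<odot> z"
    and ip_scaleR_left [simp]: "(a *\<^sub>R x) \<odot> y = a * (x \<odot> y)"
    and ip_ge_0 [simp]: "0 \<le> x \<odot> x"
    and complete: "\<forall>e>0. \<exists>K. \<forall>m\<ge>K. \<forall>n\<ge>K. (X m - X n) \<odot> (X m - X n) < e \<Longrightarrow>
      \<exists>l. (\<lambda>n. (X n - l) \<odot> (X n - l)) \<longlonglongrightarrow> 0"
begin

lemma ip_add_right: "z \<odot> (x + y) = z \<odot> x + z \<odot> y"
  by (metis ip_commute ip_add_left)

lemma ip_scaleR_right [simp]: "x \<odot> (a *\<^sub>R y) = a * (x \<odot> y)"
  by (metis ip_commute ip_scaleR_left)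

lemma ip_minus_left [simp]: "(- x) \<odot> y = - (x \<odot> y)"
  using ip_scaleR_left[of "-1" x y] by simp

lemma ip_minus_right [simp]: "x \<odot> (- y) = - (x \<odot> y)"
  by (metis ip_commute ip_minus_left)

lemma ip_zero_left [simp]: "0 \<odot> y = 0"
  using ip_scaleR_left[of 0 0 y] by simp

lemma ip_zero_right [simp]: "y \<odot> 0 = 0"
  by (metis ip_commute ip_zero_left)

lemma ip_diff_left: "(x - y) \<odot> z = x \<odot> z - y \<odot> z"
  using ip_add_left[of x "-y" z] by simp

lemma ip_diff_right: "z \<odot> (x - y) = z \<odot> x - z \<odot> y"
  using ip_add_right[of z x "-y"] by simp

lemmas ip_simps = ip_add_left ip_add_right ip_diff_left ip_diff_right

lemma sq_diff: "(x - y) \<odot> (x - y) = x \<odot> x - 2 * (x \<odot> y) + y \<odot> y"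
  by (simp add: ip_simps ip_commute[of y x])

lemma sq_add: "(x + y) \<odot> (x + y) = x \<odot> x + 2 * (x \<odot> y) + y \<odot> y"
  by (simp add: ip_simps ip_commute[of y x])

lemma sq_diff_commute: "(x - y) \<odot> (x - y) = (y - x) \<odot> (y - x)"
  by (simp add: sq_diff ip_commute)

lemma young:
  assumes "c > 0"
  shows "2 * (x \<odot> y) \<le> c * (x \<odot> x) + (y \<odot> y) / c"
proof -
  have "0 \<le> (c *\<^sub>R x - y) \<odot> (c *\<^sub>R x - y)" by (rule ip_ge_0)
  also have "\<dots> = c * (c * (x \<odot> x) - 2 * (x \<odot> y) + (y \<odot> y) / c)"
    using assms by (simp only: sq_diff) (simp add: algebra_simps)
  finally show ?thesis using assms by (simp add: zero_le_mult_iff)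
qed

lemma Cauchy_Schwarz: "(x \<odot> y)\<^sup>2 \<le> (x \<odot> x) * (y \<odot> y)"
proof (cases "y \<odot> y = 0")
  case True
  have "x \<odot> y = 0"
  proof (rule ccontr)
    assume "x \<odot> y \<noteq> 0"
    \<comment> \<open>For null \<open>y\<close> the square of \<open>x - t *\<^sub>R y\<close> is
      affine in \<open>t\<close>; this \<open>t\<close> brings it down to -1.\<close>
    define t where "t = (x \<odot> x + 1) / (2 * (x \<odot> y))"
    have "0 \<le> (x - t *\<^sub>R y) \<odot> (x - t *\<^sub>R y)" by (rule ip_ge_0)
    also have "\<dots> = -1"
      using \<open>x \<odot> y \<noteq> 0\<close> True by (simp add: sq_diff t_def field_simps)
    finally show False by simp
  qed
  then show ?thesis by simp
next
  case False
  then have pos: "y \<odot> y > 0" using ip_ge_0[of y] by linarith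
  define t where "t = (x \<odot> y) / (y \<odot> y)"
  have "0 \<le> (x - t *\<^sub>R y) \<odot> (x - t *\<^sub>R y)" by (rule ip_ge_0)
  also have "\<dots> = x \<odot> x - (x \<odot> y)\<^sup>2 / (y \<odot> y)"
    using pos by (simp add: sq_diff t_def power2_eq_square)
  finally show ?thesis using pos by (simp add: field_simps)
qed

lemma ip_le: "\<bar>x \<odot> y\<bar> \<le> sqrt (x \<odot> x) * sqrt (y \<odot> y)"
  using real_sqrt_le_mono[OF Cauchy_Schwarz[of x y]] by (simp add: real_sqrt_mult)

lemma ip_null: "x \<odot> x = 0 \<Longrightarrow> x \<odot> y = 0"
  using ip_le[of x y] by simp

lemma ip_null_diff: "(x - y) \<odot> (x - y) = 0 \<Longrightarrow> x \<odot> z = y \<odot> z"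
  using ip_null[of "x - y" z] by (simp add: ip_diff_left)

lemma sq_add_le: "(x + y) \<odot> (x + y) \<le> 2 * (x \<odot> x) + 2 * (y \<odot> y)"
  using ip_ge_0[of "x - y"] by (simp add: sq_diff sq_add)

lemma parallelogram:
  "(x - y) \<odot> (x - y) = 2 * ((z - x) \<odot> (z - x)) + 2 * ((z - y) \<odot> (z - y))
     - 4 * ((z - (1/2) *\<^sub>R (x + y)) \<odot> (z - (1/2) *\<^sub>R (x + y)))"
  by (simp add: sq_diff sq_add ip_simps ip_commute[of y x] algebra_simps)

lemma tendsto_ip_null:
  assumes "((\<lambda>k. X k \<odot> X k) \<longlongrightarrow> 0) F" and "\<forall>\<^sub>F k in F. Y k \<odot> Y k \<le> B"
  shows "((\<lambda>k. X k \<odot> Y k) \<longlongrightarrow> 0) F"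
proof (rule Lim_null_comparison)
  have "((\<lambda>k. sqrt (X k \<odot> X k) * sqrt B) \<longlongrightarrow> sqrt 0 * sqrt B) F"
    by (intro tendsto_intros assms)
  then show "((\<lambda>k. sqrt (X k \<odot> X k) * sqrt B) \<longlongrightarrow> 0) F" by simp
  show "\<forall>\<^sub>F k in F. norm (X k \<odot> Y k) \<le> sqrt (X k \<odot> X k) * sqrt B"
    using assms(2)
  proof eventually_elim
    case (elim k)
    have "sqrt (X k \<odot> X k) * sqrt (Y k \<odot> Y k) \<le> sqrt (X k \<odot> X k) * sqrt B"
      using elim by (intro mult_left_mono real_sqrt_le_mono) auto
    with ip_le[of "X k" "Y k"] show ?case by simp
  qed
qed

section \<open>Closed convex sets, metric projection and Riesz representation\<close>

definition closed_ip :: "'a set \<Rightarrow> bool" where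
  "closed_ip S \<longleftrightarrow> (\<forall>X l. (\<forall>n. X n \<in> S) \<longrightarrow> (\<lambda>n::nat. (X n - l) \<odot> (X n - l)) \<longlonglongrightarrow> 0 \<longrightarrow> l \<in> S)"

text \<open>The constant sequence \<open>x\<close> converges to every \<open>y\<close> at distance 0
  from it.\<close>

lemma closed_ip_null:
  assumes "closed_ip S" "x \<in> S" "(x - y) \<odot> (x - y) = 0"
  shows "y \<in> S"
  using assms unfolding closed_ip_def by (auto dest!: spec[of _ "\<lambda>_. x"])

text \<open>A minimizing sequence is Cauchy: midpoints stay in the convex set, so their squared
  distance from \<open>z\<close> is at least the infimum, and the parallelogram identity bounds the
  distance of two late members.\<close>

lemma projection_exists:
  assumes "convex S" "closed_ip S" "S \<noteq> {}"
  shows "\<exists>p\<in>S. \<forall>y\<in>S. (z - p) \<odot> (z - p) \<le> (z - y) \<odot> (z - y)"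
proof -
  define d where "d = (INF y\<in>S. (z - y) \<odot> (z - y))"
  have bdd: "bdd_below ((\<lambda>y. (z - y) \<odot> (z - y)) ` S)" by (rule bdd_belowI2[of _ 0]) simp
  have d_le: "d \<le> (z - y) \<odot> (z - y)" if "y \<in> S" for y
    unfolding d_def by (rule cINF_lower[OF bdd that])
  have "\<exists>y\<in>S. (z - y) \<odot> (z - y) < d + 1 / real (Suc n)" for n
    using cINF_less_iff[OF assms(3) bdd, of "d + 1 / real (Suc n)"] by (simp add: d_def)
  then obtain X where X: "\<And>n. X n \<in> S" "\<And>n. (z - X n) \<odot> (z - X n) < d + 1 / real (Suc n)"
    by metis
  have dist: "(X m - X n) \<odot> (X m - X n) \<le> 2 / real (Suc m) + 2 / real (Suc n)" for m n
  proof -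
    have "(1/2) *\<^sub>R X m + (1/2) *\<^sub>R X n \<in> S"
      by (rule convexD[OF assms(1)]) (use X in auto)
    then have "(1/2) *\<^sub>R (X m + X n) \<in> S" by (simp add: scaleR_add_right)
    from d_le[OF this] parallelogram[of "X m" "X n" z] X(2)[of m] X(2)[of n]
    show ?thesis by simp
  qed
  have inv: "(\<lambda>n. 1 / real (Suc n)) \<longlonglongrightarrow> 0"
    using LIMSEQ_inverse_real_of_nat by (simp add: inverse_eq_divide)
  have "\<forall>e>0. \<exists>K. \<forall>m\<ge>K. \<forall>n\<ge>K. (X m - X n) \<odot> (X m - X n) < e"
  proof (intro allI impI)
    fix e :: real assume "e > 0"
    then obtain K where K: "1 / real (Suc K) < e / 4"
      using reals_Archimedean[of "e/4"] by (auto simp: inverse_eq_divide)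
    have *: "1 / real (Suc n) < e / 4" if "n \<ge> K" for n
      by (rule le_less_trans[OF _ K]) (use that in \<open>simp add: field_simps\<close>)
    have "(X m - X n) \<odot> (X m - X n) < e" if "m \<ge> K" "n \<ge> K" for m n
      using dist[of m n] *[OF that(1)] *[OF that(2)] by simp
    then show "\<exists>K. \<forall>m\<ge>K. \<forall>n\<ge>K. (X m - X n) \<odot> (X m - X n) < e" by blast
  qed
  then obtain l where l: "(\<lambda>n. (X n - l) \<odot> (X n - l)) \<longlonglongrightarrow> 0" using complete by blast
  have "l \<in> S" using assms(2) X(1) l unfolding closed_ip_def by blast
  have "(\<lambda>n. (X n - l) \<odot> (z - l)) \<longlonglongrightarrow> 0"
    by (rule tendsto_ip_null[OF l, of _ "(z - l) \<odot> (z - l)"]) simp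
  then have "(\<lambda>n. (z - l) \<odot> (z - l) - 2 * ((X n - l) \<odot> (z - l)) + (X n - l) \<odot> (X n - l))
      \<longlonglongrightarrow> (z - l) \<odot> (z - l) - 2 * 0 + 0"
    by (intro tendsto_intros l)
  moreover have "(z - l) \<odot> (z - l) - 2 * ((X n - l) \<odot> (z - l)) + (X n - l) \<odot> (X n - l)
      = (z - X n) \<odot> (z - X n)" for n
    using sq_diff[of "z - l" "X n - l"] by (simp add: ip_commute)
  ultimately have "(\<lambda>n. (z - X n) \<odot> (z - X n)) \<longlonglongrightarrow> (z - l) \<odot> (z - l)" by simp
  moreover have "(\<lambda>n. d + 1 / real (Suc n)) \<longlonglongrightarrow> d + 0" by (intro tendsto_intros inv)
  ultimately have "(z - l) \<odot> (z - l) \<le> d + 0"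
    by (rule LIMSEQ_le) (use less_imp_le[OF X(2)] in blast)
  with d_le \<open>l \<in> S\<close> show ?thesis by (intro bexI[of _ l]) (auto intro: order_trans)
qed

lemma projection_variational:
  assumes "convex S" "p \<in> S" "\<forall>y\<in>S. (z - p) \<odot> (z - p) \<le> (z - y) \<odot> (z - y)" "y \<in> S"
  shows "(z - p) \<odot> (y - p) \<le> 0"
proof (rule ccontr)
  assume "\<not> ?thesis"
  then have pos: "(z - p) \<odot> (y - p) > 0" by simp
  define c where "c = (z - p) \<odot> (y - p)"
  define D where "D = (y - p) \<odot> (y - p)"
  have D: "D \<ge> 0" "c > 0" using pos by (auto simp: D_def c_def)
  \<comment> \<open>Moving from \<open>p\<close> towards \<open>y\<close> by the fraction
    \<open>t\<close> lowers the squared distance by \<open>t * (2 * c - t * D)\<close>. This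
    \<open>t\<close> keeps \<open>t * D\<close> below \<open>c\<close>; the denominator
    \<open>D + 1\<close> also covers \<open>D = 0\<close>.\<close>
  define t where "t = min 1 (c / (D + 1))"
  have t: "0 < t" "t \<le> 1" "t * (D + 1) \<le> c"
  proof -
    have "0 < c / (D + 1)" using D by simp
    then show "0 < t" "t \<le> 1" by (simp_all add: t_def)
    have "t * (D + 1) \<le> c / (D + 1) * (D + 1)"
      by (rule mult_right_mono) (use D in \<open>auto simp: t_def\<close>)
    then show "t * (D + 1) \<le> c" using D by simp
  qed
  have "(1 - t) *\<^sub>R p + t *\<^sub>R y \<in> S"
    by (rule convexD[OF assms(1)]) (use t assms in auto)
  also have "(1 - t) *\<^sub>R p + t *\<^sub>R y = p + t *\<^sub>R (y - p)" by (simp add: algebra_simps)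
  finally have "(z - p) \<odot> (z - p) \<le> (z - (p + t *\<^sub>R (y - p))) \<odot> (z - (p + t *\<^sub>R (y - p)))"
    using assms(3) by blast
  also have "z - (p + t *\<^sub>R (y - p)) = (z - p) - t *\<^sub>R (y - p)" by simp
  also have "\<dots> \<odot> \<dots> = (z - p) \<odot> (z - p) - t * (2 * c - t * D)"
    unfolding sq_diff[of "z - p"] ip_scaleR_left ip_scaleR_right
    by (simp add: c_def D_def right_diff_distrib)
  finally have "2 * c - t * D \<le> 0" using t(1) by (simp add: mult_le_0_iff)
  moreover have "t * D < c" using t by (simp add: algebra_simps)
  ultimately show False using D by linarith
qed

text \<open>The point of least norm on the hyperplane \<open>f x = 1\<close> is orthogonal to the
  kernel of \<open>f\<close>; divided by its squared norm it represents \<open>f\<close>. The bound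
  makes the hyperplane closed and keeps that norm away from 0.\<close>

lemma Riesz:
  assumes add: "\<And>x y. f (x + y) = f x + f y" and scale: "\<And>a x. f (a *\<^sub>R x) = a * f x"
    and bound: "\<And>x. (f x)\<^sup>2 \<le> B * (x \<odot> x)"
  shows "\<exists>l. \<forall>x. f x = l \<odot> x"
proof (cases "\<forall>x. f x = 0")
  case True
  then show ?thesis by (intro exI[of _ 0]) simp
next
  case False
  then obtain u where u: "f u \<noteq> 0" by blast
  have diff: "f (x - y) = f x - f y" for x y
    using add[of "x - y" y] by simp
  define S where "S = {x. f x = 1}"
  have "convex S" by (rule convexI) (auto simp: S_def add scale)
  have "(1 / f u) *\<^sub>R u \<in> S" using u by (simp add: S_def scale)
  then have "S \<noteq> {}" by blast
  have "closed_ip S"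
    unfolding closed_ip_def
  proof (intro allI impI)
    fix X l assume X: "\<forall>n. X n \<in> S" "(\<lambda>n::nat. (X n - l) \<odot> (X n - l)) \<longlonglongrightarrow> 0"
    have "(1 - f l)\<^sup>2 \<le> B * ((X n - l) \<odot> (X n - l))" for n
      using bound[of "X n - l"] X(1) by (simp add: diff S_def)
    moreover have "(\<lambda>n. B * ((X n - l) \<odot> (X n - l))) \<longlonglongrightarrow> B * 0" by (intro tendsto_intros X)
    ultimately have "(1 - f l)\<^sup>2 \<le> B * 0" by (intro LIMSEQ_le_const) auto
    then show "l \<in> S" by (simp add: S_def)
  qed
  from projection_exists[OF \<open>convex S\<close> this \<open>S \<noteq> {}\<close>, of 0] obtain p where
    p: "p \<in> S" and min: "\<forall>y\<in>S. (0 - p) \<odot> (0 - p) \<le> (0 - y) \<odot> (0 - y)" by blast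
  have orth: "p \<odot> v = 0" if "f v = 0" for v
  proof -
    have "p + v \<in> S" "p - v \<in> S" using p that unfolding S_def by (simp_all add: add diff)
    from projection_variational[OF \<open>convex S\<close> p min this(1)]
      projection_variational[OF \<open>convex S\<close> p min this(2)]
    show ?thesis by simp
  qed
  have "1 \<le> B * (p \<odot> p)" using bound[of p] p by (simp add: S_def)
  then have "p \<odot> p \<noteq> 0" by auto
  moreover have "f v * (p \<odot> p) = p \<odot> v" for v
    using orth[of "v - f v *\<^sub>R p"] p by (simp add: diff scale S_def ip_diff_right)
  ultimately have "f v = ((1 / (p \<odot> p)) *\<^sub>R p) \<odot> v" for v by (simp add: field_simps)
  then show ?thesis by blast
qed

section \<open>Weak convergence along filters: compactness and weak closedness\<close>

definition weak_tendsto :: "('b \<Rightarrow> 'a) \<Rightarrow> 'a \<Rightarrow> 'b filter \<Rightarrow> bool" where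
  "weak_tendsto X l F \<longleftrightarrow> (\<forall>v. ((\<lambda>k. X k \<odot> v) \<longlongrightarrow> l \<odot> v) F)"

lemma weak_tendstoD: "weak_tendsto X l F \<Longrightarrow> ((\<lambda>k. X k \<odot> v) \<longlongrightarrow> l \<odot> v) F"
  by (simp add: weak_tendsto_def)

lemma weak_tendsto_mono: "weak_tendsto X l F \<Longrightarrow> F' \<le> F \<Longrightarrow> weak_tendsto X l F'"
  by (auto simp: weak_tendsto_def intro: tendsto_mono)

lemma weak_tendsto_null_diff:
  assumes "weak_tendsto X l F" "((\<lambda>k. (X k - Y k) \<odot> (X k - Y k)) \<longlongrightarrow> 0) F"
  shows "weak_tendsto Y l F"
  unfolding weak_tendsto_def
proof
  fix v
  have "((\<lambda>k. (X k - Y k) \<odot> v) \<longlongrightarrow> 0) F"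
    by (rule tendsto_ip_null[OF assms(2), of _ "v \<odot> v"]) simp
  from tendsto_diff[OF weak_tendstoD[OF assms(1), of v] this]
  show "((\<lambda>k. Y k \<odot> v) \<longlongrightarrow> l \<odot> v) F" by (simp add: ip_diff_left algebra_simps)
qed

text \<open>
  Weak compactness, for filters instead of subsequences: the functionals \<open>\<lambda>v. X k \<odot> v\<close> live in a
  product of compact intervals, so Tychonoff's theorem applies without any separability argument.
\<close>

lemma weak_compact:
  assumes "\<And>k. X k \<odot> X k \<le> B" and "F \<noteq> bot"
  shows "\<exists>F' l. F' \<le> F \<and> F' \<noteq> bot \<and> weak_tendsto X l F'"
proof -
  define \<Phi> where "\<Phi> k v = X k \<odot> v" for k v
  define b where "b v = sqrt (B * (v \<odot> v))" for v
  define K where "K = Pi\<^sub>E UNIV (\<lambda>v. {- b v..b v})"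
  have "compactin (product_topology (\<lambda>_. euclidean) UNIV) K"
    unfolding K_def compactin_PiE by simp
  then have "compact K" by (simp add: euclidean_product_topology)
  have sq: "(\<Phi> k v)\<^sup>2 \<le> B * (v \<odot> v)" for k v
    unfolding \<Phi>_def using Cauchy_Schwarz[of "X k" v] mult_right_mono[OF assms(1)[of k], of "v \<odot> v"]
    by simp
  have "\<Phi> k \<in> K" for k
  proof -
    have "\<bar>\<Phi> k v\<bar> \<le> b v" for v
      unfolding b_def using real_sqrt_le_mono[OF sq[of k v]] by simp
    then have "- b v \<le> \<Phi> k v" "\<Phi> k v \<le> b v" for v by (metis abs_le_D1 abs_le_D2 minus_le_iff)+
    then show ?thesis by (auto simp: K_def PiE_iff)
  qed
  then have "\<forall>\<^sub>F f in filtermap \<Phi> F. f \<in> K" by (simp add: eventually_filtermap)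
  moreover have "filtermap \<Phi> F \<noteq> bot" using assms(2) by (simp add: filtermap_bot_iff)
  ultimately obtain f where f: "f \<in> K" "inf (nhds f) (filtermap \<Phi> F) \<noteq> bot"
    using \<open>compact K\<close> unfolding compact_filter by blast
  \<comment> \<open>The cluster point \<open>f\<close> of the image filter is pulled back to the
    index side: \<open>F'\<close> refines \<open>F\<close> by the sets of indices whose functional
    is close to \<open>f\<close>.\<close>
  define F' where "F' = inf F (filtercomap \<Phi> (nhds f))"
  have "F' \<noteq> bot"
  proof
    assume "F' = bot"
    then have "eventually (\<lambda>_. False) F'" by simp
    then obtain Q R where QR: "eventually Q F" "eventually R (nhds f)"
      "\<And>k. Q k \<Longrightarrow> R (\<Phi> k) \<Longrightarrow> False"
      unfolding F'_def eventually_inf eventually_filtercomap by blast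
    have "eventually (\<lambda>g. \<not> R g) (filtermap \<Phi> F)"
      unfolding eventually_filtermap using QR(1) by (rule eventually_mono) (use QR(3) in blast)
    with QR(2) have "eventually (\<lambda>_. False) (inf (nhds f) (filtermap \<Phi> F))"
      unfolding eventually_inf by blast
    with f(2) show False by (simp add: trivial_limit_def)
  qed
  have "F' \<le> F" by (simp add: F'_def)
  have "filterlim \<Phi> (nhds f) F'"
    unfolding filterlim_iff_le_filtercomap F'_def by simp
  then have lim: "((\<lambda>k. \<Phi> k v) \<longlongrightarrow> f v) F'" for v
    using continuous_on_tendsto_compose[OF continuous_on_product_coordinates, of \<Phi> f F' v] by simp
  \<comment> \<open>The pointwise limit inherits linearity and the bound, so it is represented by a
    vector, which becomes the weak limit.\<close>
  have "f (x + y) = f x + f y" for x y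
  proof (rule tendsto_unique[OF \<open>F' \<noteq> bot\<close> lim])
    show "((\<lambda>k. \<Phi> k (x + y)) \<longlongrightarrow> f x + f y) F'"
      using tendsto_add[OF lim[of x] lim[of y]] by (simp add: \<Phi>_def ip_add_right)
  qed
  moreover have "f (a *\<^sub>R x) = a * f x" for a x
  proof (rule tendsto_unique[OF \<open>F' \<noteq> bot\<close> lim])
    show "((\<lambda>k. \<Phi> k (a *\<^sub>R x)) \<longlongrightarrow> a * f x) F'"
      using tendsto_mult_left[OF lim[of x], of a] by (simp add: \<Phi>_def)
  qed
  moreover have "(f x)\<^sup>2 \<le> B * (x \<odot> x)" for x
    by (rule tendsto_upperbound[OF tendsto_power[OF lim]]) (use sq \<open>F' \<noteq> bot\<close> in auto)
  ultimately obtain l where "\<And>x. f x = l \<odot> x" using Riesz[of f B] by blast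
  with lim have "weak_tendsto X l F'" by (simp add: weak_tendsto_def \<Phi>_def)
  with \<open>F' \<le> F\<close> \<open>F' \<noteq> bot\<close> show ?thesis by blast
qed

text \<open>For the projection \<open>p\<close> of \<open>l\<close>, the variational inequality
  tested on \<open>X k\<close> passes to the limit against the fixed vector \<open>l - p\<close>.
  What is left says that \<open>l\<close> and \<open>p\<close> are at distance 0.\<close>

lemma closed_convex_weakly_closed:
  assumes "convex S" "closed_ip S" "F \<noteq> bot" "\<And>k. X k \<in> S" "weak_tendsto X l F"
  shows "l \<in> S"
proof -
  have "F \<noteq> bot \<Longrightarrow> S \<noteq> {}" using assms(4) by blast
  then obtain p where p: "p \<in> S" "\<forall>y\<in>S. (l - p) \<odot> (l - p) \<le> (l - y) \<odot> (l - y)"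
    using projection_exists[OF assms(1,2), of l] assms(3) by blast
  have "((\<lambda>k. X k \<odot> (l - p) - p \<odot> (l - p)) \<longlongrightarrow> l \<odot> (l - p) - p \<odot> (l - p)) F"
    by (intro tendsto_intros weak_tendstoD[OF assms(5)])
  then have "((\<lambda>k. (X k - p) \<odot> (l - p)) \<longlongrightarrow> (l - p) \<odot> (l - p)) F" by (simp add: ip_diff_left)
  then have "(l - p) \<odot> (l - p) \<le> 0"
    by (rule tendsto_upperbound)
      (use projection_variational[OF assms(1) p assms(4)] assms(3) in \<open>auto simp: ip_commute\<close>)
  then have "(p - l) \<odot> (p - l) = 0" using ip_ge_0[of "l - p"] sq_diff_commute[of p l] by linarith
  then show ?thesis by (rule closed_ip_null[OF assms(2) p(1)])
qed

end

section \<open>The prediction-correction iteration\<close>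

lemma quasi_monotone_converges:
  fixes V D :: "nat \<Rightarrow> real"
  assumes V: "\<And>k. 0 \<le> V k" and D: "\<And>k. 0 \<le> D k"
    and step: "\<And>k. V (Suc k) \<le> V k - D k + c * q ^ k"
    and q: "0 \<le> q" "q < 1" and c: "0 \<le> c"
  shows "convergent V" and "D \<longlonglongrightarrow> 0"
proof -
  \<comment> \<open>The added term is the tail of the geometric error series from index
    \<open>k\<close> on, so \<open>W\<close> absorbs the error and decreases.\<close>
  define W where "W k = V k + c / (1 - q) * q ^ k" for k
  have W_step: "W (Suc k) \<le> W k - D k" for k
  proof -
    have "c * q ^ k + c / (1 - q) * q ^ Suc k = c / (1 - q) * q ^ k"
      using q by (simp add: field_simps)
    then show ?thesis using step[of k] by (simp add: W_def)
  qed
  have "0 \<le> W k" for k using V q c by (simp add: W_def)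
  moreover have "decseq W"
    unfolding decseq_Suc_iff
  proof
    fix k show "W (Suc k) \<le> W k" using W_step[of k] D[of k] by linarith
  qed
  ultimately obtain w where w: "W \<longlonglongrightarrow> w" using decseq_convergent[of W 0] by blast
  have "(\<lambda>k. q ^ k) \<longlonglongrightarrow> 0" using q by (intro LIMSEQ_power_zero) simp
  from tendsto_diff[OF w tendsto_mult_left[OF this, of "c / (1 - q)"]]
  show "convergent V" unfolding convergent_def W_def by auto
  have "(\<lambda>k. W k - W (Suc k)) \<longlonglongrightarrow> w - w" by (intro tendsto_intros w LIMSEQ_Suc)
  then have lim: "(\<lambda>k. W k - W (Suc k)) \<longlonglongrightarrow> 0" by simp
  have "D k \<le> W k - W (Suc k)" for k using W_step[of k] by simp
  then show "D \<longlonglongrightarrow> 0"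
    by (intro tendsto_sandwich[OF _ _ tendsto_const lim] always_eventually allI) (use D in auto)
qed

text \<open>The projections enter through their variational inequalities alone, which keeps measure
  theory out of the convergence argument. Feasibility is recorded for the predictions
  \<open>xt k\<close>; the corrected \<open>x k\<close> may leave \<open>C\<close>.\<close>

locale semi_hilbert_admm = semi_hilbert ip
  for ip :: "'a::real_vector \<Rightarrow> 'a \<Rightarrow> real"  (infixl "\<odot>" 70) +
  fixes C N :: "'a set" and F :: "'a \<Rightarrow> 'a" and L \<beta> r \<alpha> :: real
    and x y l xt yt lt :: "nat \<Rightarrow> 'a"
  assumes C: "convex C" "closed_ip C" and N: "subspace N" "closed_ip N"
    and F_mono: "0 \<le> (F u - F v) \<odot> (u - v)"
    and F_lip: "(F u - F v) \<odot> (F u - F v) \<le> L\<^sup>2 * ((u - v) \<odot> (u - v))"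
    and L: "0 \<le> L" and \<beta>: "0 < \<beta>" and r: "L / \<beta> + 1 < r" and \<alpha>: "0 < \<alpha>" "\<alpha> < 1"
    and xt_in: "xt k \<in> C"
    and xt_var: "u \<in> C \<Longrightarrow>
      (x k - (1 / (\<beta> * r)) *\<^sub>R (F (x k) - l k + \<beta> *\<^sub>R (x k - y k)) - xt k) \<odot> (u - xt k) \<le> 0"
    and yt_in: "yt k \<in> N"
    and yt_var: "v \<in> N \<Longrightarrow>
      (y k - (1 / \<beta>) *\<^sub>R (l k - \<beta> *\<^sub>R (xt k - y k)) - yt k) \<odot> (v - yt k) \<le> 0"
    and lt: "lt k = l k - \<beta> *\<^sub>R (xt k - yt k)"
    and x_Suc: "x (Suc k) = x k - \<alpha> *\<^sub>R (x k - xt k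
      - (1 / (\<beta> * r)) *\<^sub>R (F (x k) - F (xt k) + \<beta> *\<^sub>R (x k - xt k)))"
    and y_Suc: "y (Suc k) = y k - \<alpha> *\<^sub>R (y k - yt k)"
    and l_Suc: "l (Suc k) = l k - \<alpha> *\<^sub>R (l k - lt k)"
    and y_0: "y 0 \<in> N"
begin

section \<open>Optimality conditions of the prediction and size of the error term\<close>

lemma convex_N: "convex N"
  using N(1) by (auto intro!: convexI simp: subspace_def)

abbreviation (input) "a \<equiv> \<beta> * r"
abbreviation (input) "dx k \<equiv> x k - xt k"
abbreviation (input) "dy k \<equiv> y k - yt k"
abbreviation (input) "dl k \<equiv> l k - lt k"
text \<open>This is the increment of F + \<beta> id from \<open>xt k\<close> to
  \<open>x k\<close>.\<close>

definition "\<zeta> k = F (x k) - F (xt k) + \<beta> *\<^sub>R dx k"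

lemma a_gt: "L + \<beta> < a"
  using r \<beta> by (simp add: field_simps)

lemma a_pos: "0 < a" and r_pos: "0 < r"
proof -
  show "0 < a" using a_gt L \<beta> by linarith
  then show "0 < r" using \<beta> by (simp add: zero_less_mult_iff)
qed

lemma dl_eq: "dl k = \<beta> *\<^sub>R (xt k - yt k)"
  by (simp add: lt)

lemma y_in: "y k \<in> N"
proof (induction k)
  case (Suc k)
  then show ?case using N(1) yt_in[of k]
    by (simp add: y_Suc subspace_diff subspace_scale)
qed (rule y_0)

text \<open>The first factor in \<open>yt_var\<close> collapses to \<open>lt k\<close> times
  -1/\<beta>. On a linear subspace the variational inequality can be tested in both directions,
  hence is an equality.\<close>

lemma lt_orth:
  assumes "v \<in> N" shows "lt k \<odot> v = 0"
proof -
  have eq: "y k - (1 / \<beta>) *\<^sub>R (l k - \<beta> *\<^sub>R (xt k - y k)) - yt k = - ((1 / \<beta>) *\<^sub>R lt k)"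
    using \<beta> by (simp add: lt algebra_simps)
  have "yt k + v \<in> N" "yt k - v \<in> N"
    using assms yt_in N(1) by (auto intro: subspace_add subspace_diff)
  from yt_var[OF this(1), of k] yt_var[OF this(2), of k] show ?thesis
    using \<beta> unfolding eq by (simp add: divide_le_0_iff zero_le_divide_iff)
qed

text \<open>The correction is the convex combination of \<open>l k\<close> with weight 1 - \<alpha>
  and \<open>lt k\<close> with weight \<alpha>, and the latter is invisible on
  \<open>N\<close>.\<close>

lemma l_on_N:
  assumes "v \<in> N" shows "l k \<odot> v = (1 - \<alpha>) ^ k * (l 0 \<odot> v)"
proof (induction k)
  case (Suc k)
  then show ?case
    unfolding l_Suc using lt_orth[OF assms, of k] by (simp add: ip_simps algebra_simps)
qed simp

lemma sq_\<zeta>: "\<zeta> k \<odot> \<zeta> k \<le> (L + \<beta>)\<^sup>2 * (dx k \<odot> dx k)"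
proof -
  define f where "f = F (x k) - F (xt k)"
  define d where "d = dx k"
  have f: "f \<odot> f \<le> L\<^sup>2 * (d \<odot> d)" unfolding f_def d_def by (rule F_lip)
  have "f \<odot> d \<le> sqrt (f \<odot> f) * sqrt (d \<odot> d)" using ip_le[of f d] by simp
  also have "\<dots> \<le> (L * sqrt (d \<odot> d)) * sqrt (d \<odot> d)"
    using real_sqrt_le_mono[OF f] L by (intro mult_right_mono) (auto simp: real_sqrt_mult)
  finally have fd: "f \<odot> d \<le> L * (d \<odot> d)" by (simp add: mult.assoc)
  have "\<zeta> k \<odot> \<zeta> k = f \<odot> f + 2 * \<beta> * (f \<odot> d) + \<beta>\<^sup>2 * (d \<odot> d)"
    unfolding \<zeta>_def f_def[symmetric] d_def[symmetric] sq_add by (simp add: power2_eq_square)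
  also have "\<dots> \<le> L\<^sup>2 * (d \<odot> d) + 2 * \<beta> * (L * (d \<odot> d)) + \<beta>\<^sup>2 * (d \<odot> d)"
    using f fd \<beta> by (intro add_mono mult_left_mono) auto
  also have "\<dots> = (L + \<beta>)\<^sup>2 * (d \<odot> d)" by (simp add: power2_eq_square algebra_simps)
  finally show ?thesis by (simp add: d_def)
qed

lemma ip_\<zeta>: "\<bar>dx k \<odot> \<zeta> k\<bar> \<le> (L + \<beta>) * (dx k \<odot> dx k)"
proof -
  have "\<bar>dx k \<odot> \<zeta> k\<bar> \<le> sqrt (dx k \<odot> dx k) * sqrt (\<zeta> k \<odot> \<zeta> k)" by (rule ip_le)
  also have "\<dots> \<le> sqrt (dx k \<odot> dx k) * ((L + \<beta>) * sqrt (dx k \<odot> dx k))"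
    using real_sqrt_le_mono[OF sq_\<zeta>[of k]] L \<beta>
    by (intro mult_left_mono) (auto simp: real_sqrt_mult)
  finally show ?thesis by (simp add: algebra_simps)
qed

text \<open>Regrouping with \<open>\<zeta> k\<close> and \<open>lt k\<close> moves F and the
  multiplier from the iterate to the prediction, the form that can be compared with the inequality
  satisfied by a solution.\<close>

lemma xt_var':
  assumes "u \<in> C"
  shows "(a *\<^sub>R dx k - \<zeta> k + \<beta> *\<^sub>R dy k - F (xt k) + lt k) \<odot> (u - xt k) \<le> 0"
proof -
  define w where "w = x k - (1 / a) *\<^sub>R (F (x k) - l k + \<beta> *\<^sub>R (x k - y k)) - xt k"
  have "a *\<^sub>R dx k - \<zeta> k + \<beta> *\<^sub>R dy k - F (xt k) + lt k
      = a *\<^sub>R dx k - (F (x k) - l k + \<beta> *\<^sub>R (x k - y k))"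
    by (simp add: \<zeta>_def lt algebra_simps)
  also have "\<dots> = a *\<^sub>R w"
    using \<beta> r_pos unfolding w_def scaleR_right_diff_distrib by simp
  finally show ?thesis
    using xt_var[OF assms, of k] a_pos unfolding w_def[symmetric] by (simp add: mult_le_0_iff)
qed

text \<open>
  The solutions of the variational inequality of \<open>T\<close> over \<open>C \<times> N \<times> UNIV\<close>, with the conditions
  on the second and third component worked out.
\<close>

definition sol :: "'a \<Rightarrow> 'a \<Rightarrow> 'a \<Rightarrow> bool" where
  "sol xs ys ls \<longleftrightarrow> xs \<in> C \<and> ys \<in> N \<and> (xs - ys) \<odot> (xs - ys) = 0 \<and> (\<forall>v\<in>N. ls \<odot> v = 0)
     \<and> (\<forall>u\<in>C. 0 \<le> (F xs - ls) \<odot> (u - xs))"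

text \<open>Optimality of \<open>xt k\<close> tested at \<open>xs\<close>, the inequality for
  \<open>xs\<close> tested at \<open>xt k\<close>, and monotonicity together eliminate F. As
  \<open>xs\<close> and \<open>ys\<close> differ by a null vector, \<open>xt k - xs\<close> acts
  like \<open>yt k - ys\<close> plus \<open>dl k\<close> divided by \<beta>. In the multiplier term
  the part in \<open>N\<close> drops out by orthogonality; in the \<open>dy\<close> term the second
  part produces the cross term.\<close>

lemma prediction_ineq:
  assumes "sol xs ys ls"
  shows "- (dy k \<odot> dl k) \<le> (a *\<^sub>R dx k - \<zeta> k) \<odot> (xt k - xs) + \<beta> * (dy k \<odot> (yt k - ys))
    + (1 / \<beta>) * (dl k \<odot> (lt k - ls))"
proof -
  define D where "D = a *\<^sub>R dx k - \<zeta> k"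
  have xs: "xs \<in> C" and ys: "ys \<in> N" and ls: "\<And>v. v \<in> N \<Longrightarrow> ls \<odot> v = 0"
    and eq: "\<And>z. xs \<odot> z = ys \<odot> z" and vi: "0 \<le> (F xs - ls) \<odot> (xt k - xs)"
    using assms xt_in[of k] ip_null_diff by (auto simp: sol_def)
  have eq': "z \<odot> xs = z \<odot> ys" for z using eq[of z] by (simp add: ip_commute)
  have xt_eq: "z \<odot> xt k = z \<odot> yt k + (1 / \<beta>) * (z \<odot> dl k)" for z
    using \<beta> by (simp add: dl_eq ip_diff_right)
  note orth = lt_orth[OF ys, of k] lt_orth[OF yt_in, of k k] ls[OF ys] ls[OF yt_in[of k]]
  have "(D + \<beta> *\<^sub>R dy k - F (xt k) + lt k) \<odot> (xs - xt k) \<le> 0"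
    unfolding D_def using xt_var'[OF xs, of k] by simp
  moreover have "0 \<le> (F (xt k) - F xs) \<odot> (xt k - xs)" by (rule F_mono)
  ultimately have "0 \<le> D \<odot> (xt k - xs) + \<beta> * (dy k \<odot> (xt k - xs)) + (lt k - ls) \<odot> (xt k - xs)"
    using vi by (simp add: ip_simps algebra_simps)
  also have "(lt k - ls) \<odot> (xt k - xs) = (1 / \<beta>) * ((lt k - ls) \<odot> dl k)"
    unfolding ip_diff_right[of _ "xt k"] eq' xt_eq using orth by (simp add: ip_diff_left)
  also have "dy k \<odot> (xt k - xs) = dy k \<odot> (yt k - ys) + (1 / \<beta>) * (dy k \<odot> dl k)"
    unfolding ip_diff_right[of _ "xt k"] eq' xt_eq by (simp add: ip_diff_right)
  finally show ?thesis
    using \<beta> unfolding D_def[symmetric] by (simp add: ip_commute[of "lt k - ls"] distrib_left)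
qed

section \<open>Lyapunov function and its decrease\<close>

definition "V xs ys ls k = a * ((x k - xs) \<odot> (x k - xs)) + \<beta> * ((y k - ys) \<odot> (y k - ys))
  + (1 / \<beta>) * ((l k - ls) \<odot> (l k - ls))"

text \<open>These are the decreases that survive. Relaxation yields the factor
  \<open>2 * \<alpha> - \<alpha>\<^sup>2\<close> for \<open>y\<close> and \<open>l\<close>. For
  \<open>l\<close> it is bounded below by \<alpha>; for \<open>y\<close> it splits into \<alpha> and
  \<open>\<alpha> * (1 - \<alpha>)\<close>, and the second share is spent on the cross term.\<close>

definition "D k = 2 * \<alpha> * (1 - \<alpha>) * (a - (L + \<beta>)) * (dx k \<odot> dx k) + \<alpha> * \<beta> * (dy k \<odot> dy k)
  + (\<alpha> / \<beta>) * (dl k \<odot> dl k)"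

lemma D_ge_0: "0 \<le> D k"
  unfolding D_def using \<alpha> \<beta> a_gt by (intro add_nonneg_nonneg mult_nonneg_nonneg) auto

lemma V_ge_0: "0 \<le> V xs ys ls k"
  unfolding V_def using \<beta> r_pos by (intro add_nonneg_nonneg mult_nonneg_nonneg) auto

lemma relax_sq:
  "(p - \<alpha> *\<^sub>R (p - q) - s) \<odot> (p - \<alpha> *\<^sub>R (p - q) - s)
    = (p - s) \<odot> (p - s) - 2 * \<alpha> * ((p - q) \<odot> (q - s)) - (2 * \<alpha> - \<alpha>\<^sup>2) * ((p - q) \<odot> (p - q))"
proof -
  define d e where "d = p - q" and "e = q - s"
  have eqs: "p - \<alpha> *\<^sub>R (p - q) - s = (e + d) - \<alpha> *\<^sub>R d" "p - s = e + d"
    by (simp_all add: d_def e_def)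
  show ?thesis
    unfolding eqs
    unfolding d_def[symmetric] e_def[symmetric] sq_diff[of "e + d"] sq_add
    by (simp add: ip_add_left ip_commute[of e d] power2_eq_square algebra_simps)
qed

text \<open>The correction moves along \<open>G = a *\<^sub>R d - \<zeta> k\<close>. Since
  \<open>\<zeta> k\<close> is no longer than \<open>a *\<^sub>R d\<close>, the square of
  \<open>G\<close> is at most \<open>2 * a * (d \<odot> G)\<close>. The second-order term thus costs
  at most the fraction \<alpha> of the first-order gain, and \<open>1 - \<alpha>\<close> of it
  remains.\<close>

lemma relax_x:
  "a * ((x (Suc k) - xs) \<odot> (x (Suc k) - xs)) \<le> a * ((x k - xs) \<odot> (x k - xs))
    - 2 * \<alpha> * ((a *\<^sub>R dx k - \<zeta> k) \<odot> (xt k - xs))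
    - 2 * \<alpha> * (1 - \<alpha>) * (a - (L + \<beta>)) * (dx k \<odot> dx k)"
proof -
  define d where "d = dx k"
  define G where "G = a *\<^sub>R d - \<zeta> k"
  define e where "e = xt k - xs"
  define n where "n = d \<odot> d"
  have n: "n \<ge> 0" by (simp add: n_def)
  have G: "G = a *\<^sub>R (d - (1 / a) *\<^sub>R \<zeta> k)"
    using \<beta> r_pos unfolding G_def scaleR_right_diff_distrib by simp
  have G': "d - (1 / a) *\<^sub>R \<zeta> k = (1 / a) *\<^sub>R G"
    unfolding G using \<beta> r_pos by (simp only: scaleR_scaleR) simp
  have "x (Suc k) - xs = (e + d) - (\<alpha> / a) *\<^sub>R G"
  proof -
    have "x (Suc k) = x k - \<alpha> *\<^sub>R (d - (1 / a) *\<^sub>R \<zeta> k)"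
      by (simp only: x_Suc \<zeta>_def d_def)
    then show ?thesis unfolding G' by (simp add: e_def d_def)
  qed
  then have "(x (Suc k) - xs) \<odot> (x (Suc k) - xs)
      = (e + d) \<odot> (e + d) - 2 * (\<alpha> / a) * ((e + d) \<odot> G) + (\<alpha> / a)\<^sup>2 * (G \<odot> G)"
    by (simp add: sq_diff[of "e + d"] power2_eq_square)
  then have "a * ((x (Suc k) - xs) \<odot> (x (Suc k) - xs))
      = a * ((e + d) \<odot> (e + d)) - 2 * \<alpha> * ((e + d) \<odot> G) + \<alpha>\<^sup>2 * ((G \<odot> G) / a)"
    using \<beta> r_pos by (simp add: power2_eq_square right_diff_distrib distrib_left)
  moreover have "(G \<odot> G) / a \<le> 2 * (d \<odot> G)"
  proof -
    have "G \<odot> G = a * (2 * (d \<odot> G)) - a\<^sup>2 * n + \<zeta> k \<odot> \<zeta> k"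
      unfolding G_def sq_diff[of "a *\<^sub>R d"]
      by (simp add: n_def ip_diff_right power2_eq_square algebra_simps)
    moreover have "\<zeta> k \<odot> \<zeta> k \<le> (L + \<beta>)\<^sup>2 * n" using sq_\<zeta>[of k] by (simp add: n_def d_def)
    moreover have "(L + \<beta>)\<^sup>2 * n \<le> a\<^sup>2 * n"
      using a_gt L \<beta> n by (intro mult_right_mono power_mono) auto
    ultimately have "G \<odot> G \<le> a * (2 * (d \<odot> G))" by linarith
    then show ?thesis using a_pos by (simp add: pos_divide_le_eq mult.commute)
  qed
  then have "\<alpha>\<^sup>2 * ((G \<odot> G) / a) \<le> \<alpha>\<^sup>2 * (2 * (d \<odot> G))" by (rule mult_left_mono) simp
  moreover have "(a - (L + \<beta>)) * n \<le> d \<odot> G"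
    using ip_\<zeta>[of k] by (simp add: G_def n_def d_def[symmetric] ip_diff_right left_diff_distrib)
  then have "2 * \<alpha> * (1 - \<alpha>) * ((a - (L + \<beta>)) * n) \<le> 2 * \<alpha> * (1 - \<alpha>) * (d \<odot> G)"
    using \<alpha> by (intro mult_left_mono) auto
  moreover have "x k - xs = e + d" by (simp add: e_def d_def)
  ultimately show ?thesis
    unfolding G_def[symmetric] d_def[symmetric] e_def[symmetric] n_def[symmetric]
    by (simp add: ip_add_left ip_commute[of G e] power2_eq_square algebra_simps)
qed

lemma Fejer_step:
  assumes "sol xs ys ls"
  shows "V xs ys ls (Suc k)
    \<le> V xs ys ls k - D k + \<alpha> / (\<beta> * (1 - \<alpha>)) * (l 0 \<odot> l 0) * ((1 - \<alpha>)\<^sup>2) ^ k"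
proof -
  have "dy k \<in> N" using N(1) y_in yt_in by (intro subspace_diff)
  \<comment> \<open>On \<open>N\<close> the predicted multiplier vanishes and \<open>l k\<close> is
    the damped initial multiplier.\<close>
  then have "dy k \<odot> dl k = dy k \<odot> ((1 - \<alpha>) ^ k *\<^sub>R l 0)"
    using l_on_N[of "dy k" k] lt_orth[of "dy k" k]
    by (simp add: ip_diff_right ip_commute[of "dy k"])
  \<comment> \<open>The Young weight \<open>\<beta> * (1 - \<alpha>)\<close> is chosen so that,
    after multiplication by \<alpha>, its first term is exactly the share of the \<open>y\<close>
    decrease reserved for the cross term; the second term is geometric in \<open>k\<close>.\<close>
  then have "2 * (dy k \<odot> dl k)
      \<le> \<beta> * (1 - \<alpha>) * (dy k \<odot> dy k) + (l 0 \<odot> l 0) * ((1 - \<alpha>)\<^sup>2) ^ k / (\<beta> * (1 - \<alpha>))"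
    using young[of "\<beta> * (1 - \<alpha>)" "dy k" "(1 - \<alpha>) ^ k *\<^sub>R l 0"] \<beta> \<alpha>
    by (simp add: power2_eq_square power_mult_distrib mult.commute mult.left_commute)
  then have "\<alpha> * (2 * (dy k \<odot> dl k))
      \<le> \<alpha> * (\<beta> * (1 - \<alpha>) * (dy k \<odot> dy k) + (l 0 \<odot> l 0) * ((1 - \<alpha>)\<^sup>2) ^ k / (\<beta> * (1 - \<alpha>)))"
    using \<alpha> by (intro mult_left_mono) auto
  then have err: "2 * \<alpha> * (dy k \<odot> dl k) \<le> \<alpha> * \<beta> * (1 - \<alpha>) * (dy k \<odot> dy k)
      + \<alpha> / (\<beta> * (1 - \<alpha>)) * (l 0 \<odot> l 0) * ((1 - \<alpha>)\<^sup>2) ^ k"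
    by (simp add: distrib_left mult.assoc)
  define P where "P = (a *\<^sub>R dx k - \<zeta> k) \<odot> (xt k - xs)"
  define Q where "Q = dy k \<odot> (yt k - ys)"
  define R where "R = dl k \<odot> (lt k - ls)"
  define E where "E = \<alpha> / (\<beta> * (1 - \<alpha>)) * (l 0 \<odot> l 0) * ((1 - \<alpha>)\<^sup>2) ^ k"
  have "2 * \<alpha> * (- (dy k \<odot> dl k)) \<le> 2 * \<alpha> * (P + \<beta> * Q + (1 / \<beta>) * R)"
    using prediction_ineq[OF assms, of k] \<alpha> unfolding P_def Q_def R_def
    by (intro mult_left_mono) auto
  then have pred: "- 2 * \<alpha> * (P + \<beta> * Q + (1 / \<beta>) * R) \<le> 2 * \<alpha> * (dy k \<odot> dl k)" by simp
  have X: "a * ((x (Suc k) - xs) \<odot> (x (Suc k) - xs)) \<le> a * ((x k - xs) \<odot> (x k - xs))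
      - 2 * \<alpha> * P - 2 * \<alpha> * (1 - \<alpha>) * (a - (L + \<beta>)) * (dx k \<odot> dx k)"
    unfolding P_def by (rule relax_x)
  have Y: "\<beta> * ((y (Suc k) - ys) \<odot> (y (Suc k) - ys)) = \<beta> * ((y k - ys) \<odot> (y k - ys))
      - 2 * \<alpha> * \<beta> * Q - (2 * \<alpha> - \<alpha>\<^sup>2) * \<beta> * (dy k \<odot> dy k)"
    unfolding y_Suc relax_sq Q_def by (simp add: algebra_simps)
  have Z: "(1 / \<beta>) * ((l (Suc k) - ls) \<odot> (l (Suc k) - ls)) = (1 / \<beta>) * ((l k - ls) \<odot> (l k - ls))
      - 2 * \<alpha> * ((1 / \<beta>) * R) - (2 * \<alpha> - \<alpha>\<^sup>2) * ((1 / \<beta>) * (dl k \<odot> dl k))"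
    unfolding l_Suc relax_sq R_def by (simp only: right_diff_distrib) (simp add: mult.commute mult.left_commute)
  have "\<alpha>\<^sup>2 \<le> \<alpha>" using \<alpha> by (simp add: power2_eq_square mult_left_le)
  then have "\<alpha> * ((1 / \<beta>) * (dl k \<odot> dl k)) \<le> (2 * \<alpha> - \<alpha>\<^sup>2) * ((1 / \<beta>) * (dl k \<odot> dl k))"
    using \<beta> by (intro mult_right_mono) auto
  moreover have "(2 * \<alpha> - \<alpha>\<^sup>2) * \<beta> * (dy k \<odot> dy k)
      = \<alpha> * \<beta> * (1 - \<alpha>) * (dy k \<odot> dy k) + \<alpha> * \<beta> * (dy k \<odot> dy k)"
    by (simp add: algebra_simps power2_eq_square)
  ultimately have "V xs ys ls (Suc k) \<le> V xs ys ls k - 2 * \<alpha> * (P + \<beta> * Q + (1 / \<beta>) * R)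
      - \<alpha> * \<beta> * (1 - \<alpha>) * (dy k \<odot> dy k) - D k"
    using X Y Z unfolding V_def D_def by (simp add: distrib_left)
  with pred err show ?thesis unfolding E_def[symmetric] by linarith
qed

lemma V_converges:
  assumes "sol xs ys ls" shows "convergent (V xs ys ls)"
  by (rule quasi_monotone_converges(1)[OF V_ge_0 D_ge_0 Fejer_step[OF assms]])
    (use \<alpha> \<beta> in \<open>auto simp: abs_square_less_1\<close>)

lemma differences_vanish:
  assumes "sol xs ys ls"
  shows "(\<lambda>k. dx k \<odot> dx k) \<longlonglongrightarrow> 0" and "(\<lambda>k. dy k \<odot> dy k) \<longlonglongrightarrow> 0"
    and "(\<lambda>k. dl k \<odot> dl k) \<longlonglongrightarrow> 0"
proof -
  have D: "D \<longlonglongrightarrow> 0"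
    by (rule quasi_monotone_converges(2)[OF V_ge_0 D_ge_0 Fejer_step[OF assms]])
      (use \<alpha> \<beta> in \<open>auto simp: abs_square_less_1\<close>)
  have *: "S \<longlonglongrightarrow> 0" if "c > 0" "\<And>k. 0 \<le> S k" "\<And>k. c * S k \<le> D k" for c and S :: "nat \<Rightarrow> real"
  proof -
    have "(\<lambda>k. c * S k) \<longlonglongrightarrow> 0"
      by (rule tendsto_sandwich[OF _ _ tendsto_const D]) (use that in auto)
    from tendsto_mult_left[OF this, of "1 / c"] show ?thesis using that(1) by simp
  qed
  have pos: "0 \<le> 2 * \<alpha> * (1 - \<alpha>) * (a - (L + \<beta>)) * (dx k \<odot> dx k)"
    "0 \<le> \<alpha> * \<beta> * (dy k \<odot> dy k)" "0 \<le> \<alpha> / \<beta> * (dl k \<odot> dl k)" for k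
    using \<alpha> \<beta> a_gt by (auto intro!: mult_nonneg_nonneg)
  show "(\<lambda>k. dx k \<odot> dx k) \<longlonglongrightarrow> 0"
    by (rule *[of "2 * \<alpha> * (1 - \<alpha>) * (a - (L + \<beta>))"]) (use \<alpha> a_gt pos in \<open>auto simp: D_def\<close>)
  show "(\<lambda>k. dy k \<odot> dy k) \<longlonglongrightarrow> 0"
    by (rule *[of "\<alpha> * \<beta>"]) (use \<alpha> \<beta> pos in \<open>auto simp: D_def\<close>)
  show "(\<lambda>k. dl k \<odot> dl k) \<longlonglongrightarrow> 0"
    by (rule *[of "\<alpha> / \<beta>"]) (use \<alpha> \<beta> pos in \<open>auto simp: D_def\<close>)
qed

lemma iterates_bounded:
  assumes "sol xs ys ls"
  shows "\<exists>B. \<forall>k. x k \<odot> x k \<le> B \<and> y k \<odot> y k \<le> B \<and> l k \<odot> l k \<le> B"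
proof -
  obtain K where K: "\<And>k. V xs ys ls k \<le> K"
    using convergent_imp_Bseq[OF V_converges[OF assms]] unfolding Bseq_def by (force simp: abs_le_iff)
  have *: "p \<odot> p \<le> 2 * (K / c) + 2 * (s \<odot> s)" if "c > 0" "c * ((p - s) \<odot> (p - s)) \<le> K" for p s c
  proof -
    have "(p - s) \<odot> (p - s) \<le> K / c" using that by (simp add: pos_le_divide_eq mult.commute)
    then show ?thesis using sq_add_le[of "p - s" s] by simp
  qed
  have pos: "0 \<le> a * ((x k - xs) \<odot> (x k - xs))" "0 \<le> \<beta> * ((y k - ys) \<odot> (y k - ys))"
    "0 \<le> 1 / \<beta> * ((l k - ls) \<odot> (l k - ls))" for k
    using \<beta> r_pos by auto
  have xyz: "a * ((x k - xs) \<odot> (x k - xs)) \<le> K" "\<beta> * ((y k - ys) \<odot> (y k - ys)) \<le> K"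
    "1 / \<beta> * ((l k - ls) \<odot> (l k - ls)) \<le> K" for k
    using K[of k] pos[of k] unfolding V_def by linarith+
  show ?thesis
    using *[OF a_pos xyz(1)] *[OF \<beta> xyz(2)] *[OF _ xyz(3)] \<beta>
    by (intro exI[of _ "max (2 * (K / a) + 2 * (xs \<odot> xs))
        (max (2 * (K / \<beta>) + 2 * (ys \<odot> ys)) (2 * (K / (1 / \<beta>)) + 2 * (ls \<odot> ls)))"])
      (auto simp: le_max_iff_disj)
qed

section \<open>Weak cluster points and convergence of the whole sequence\<close>

lemma weak_null:
  assumes "G \<noteq> bot" "weak_tendsto X p G" "((\<lambda>k. X k \<odot> X k) \<longlongrightarrow> 0) G"
  shows "p \<odot> p = 0"
proof (rule tendsto_unique[OF assms(1) weak_tendstoD[OF assms(2)]])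
  show "((\<lambda>k. X k \<odot> p) \<longlongrightarrow> 0) G" by (rule tendsto_ip_null[OF assms(3), of _ "p \<odot> p"]) simp
qed

text \<open>Weak limits yield the inequality with F at the test point. Testing on the segment from
  \<open>xs\<close> to \<open>u\<close> and cancelling the step \<open>t\<close> leaves F at
  \<open>xs\<close> up to a Lipschitz error proportional to \<open>t\<close>, which vanishes as
  \<open>t\<close> tends to 0.\<close>

lemma Minty:
  assumes "xs \<in> C" and "\<And>u. u \<in> C \<Longrightarrow> 0 \<le> (F u - ls) \<odot> (u - xs)" and "u \<in> C"
  shows "0 \<le> (F xs - ls) \<odot> (u - xs)"
proof -
  define d where "d = u - xs"
  have le: "0 \<le> (F xs - ls) \<odot> d + t * (L * (d \<odot> d))" if t: "0 < t" "t \<le> 1" for t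
  proof -
    define w where "w = xs + t *\<^sub>R d"
    have "(1 - t) *\<^sub>R xs + t *\<^sub>R u \<in> C" by (rule convexD[OF C(1)]) (use assms t in auto)
    then have "w \<in> C" by (simp add: w_def d_def algebra_simps)
    from assms(2)[OF this] have "0 \<le> (F w - ls) \<odot> d" using t by (simp add: w_def zero_le_mult_iff)
    also have "\<dots> = (F xs - ls) \<odot> d + (F w - F xs) \<odot> d" by (simp add: ip_simps)
    also have "(F w - F xs) \<odot> d \<le> sqrt ((F w - F xs) \<odot> (F w - F xs)) * sqrt (d \<odot> d)"
      using ip_le[of "F w - F xs" d] by simp
    also
    have "(w - xs) \<odot> (w - xs) = t\<^sup>2 * (d \<odot> d)" by (simp add: w_def power2_eq_square)
    then have "sqrt ((F w - F xs) \<odot> (F w - F xs)) \<le> L * (t * sqrt (d \<odot> d))"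
      using real_sqrt_le_mono[OF F_lip[of w xs]] L t by (simp add: real_sqrt_mult)
    then have "sqrt ((F w - F xs) \<odot> (F w - F xs)) * sqrt (d \<odot> d)
        \<le> (L * (t * sqrt (d \<odot> d))) * sqrt (d \<odot> d)"
      by (rule mult_right_mono) simp
    finally show ?thesis by (simp add: mult.assoc mult.left_commute)
  qed
  have "((\<lambda>t. (F xs - ls) \<odot> d + t * (L * (d \<odot> d))) \<longlongrightarrow> (F xs - ls) \<odot> d + 0 * (L * (d \<odot> d))) (at_right 0)"
    by (intro tendsto_intros)
  moreover have "\<forall>\<^sub>F t in at_right 0. 0 \<le> (F xs - ls) \<odot> d + t * (L * (d \<odot> d))"
    by (rule eventually_mono[OF eventually_at_right_real[OF zero_less_one]]) (use le in auto)
  ultimately have "0 \<le> (F xs - ls) \<odot> d + 0 * (L * (d \<odot> d))"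
    by (rule tendsto_lowerbound) simp
  then show ?thesis by (simp add: d_def)
qed

lemma weak_cluster_sol:
  assumes ex: "sol x0 y0 l0" and G: "G \<noteq> bot" "G \<le> sequentially"
    and x: "weak_tendsto x xs G" and y: "weak_tendsto y ys G" and l: "weak_tendsto l ls G"
  shows "sol xs ys ls"
proof -
  note van = differences_vanish[OF ex, THEN tendsto_mono[OF G(2)]]
  obtain B where B: "\<And>k. x k \<odot> x k \<le> B" "\<And>k. y k \<odot> y k \<le> B" "\<And>k. l k \<odot> l k \<le> B"
    using iterates_bounded[OF ex] by metis
  have xt: "weak_tendsto xt xs G" by (rule weak_tendsto_null_diff[OF x van(1)])
  have yt: "weak_tendsto yt ys G" by (rule weak_tendsto_null_diff[OF y van(2)])
  have lt': "weak_tendsto lt ls G" by (rule weak_tendsto_null_diff[OF l van(3)])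
  have xs: "xs \<in> C" by (rule closed_convex_weakly_closed[OF C G(1) xt_in xt])
  have ys: "ys \<in> N" by (rule closed_convex_weakly_closed[OF convex_N N(2) G(1) yt_in yt])
  have ls: "ls \<odot> v = 0" if "v \<in> N" for v
    using tendsto_unique[OF G(1) weak_tendstoD[OF lt', of v], of 0] lt_orth[OF that] by simp
  have "((\<lambda>k. (1 / \<beta>\<^sup>2) * (dl k \<odot> dl k)) \<longlongrightarrow> (1 / \<beta>\<^sup>2) * 0) G" by (intro tendsto_intros van)
  moreover have "(1 / \<beta>\<^sup>2) * (dl k \<odot> dl k) = (xt k - yt k) \<odot> (xt k - yt k)" for k
    using \<beta> by (simp add: dl_eq power2_eq_square)
  ultimately have "((\<lambda>k. (xt k - yt k) \<odot> (xt k - yt k)) \<longlongrightarrow> 0) G" by simp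
  moreover have "weak_tendsto (\<lambda>k. xt k - yt k) (xs - ys) G"
    unfolding weak_tendsto_def ip_diff_left by (intro allI tendsto_intros weak_tendstoD xt yt)
  ultimately have eq: "(xs - ys) \<odot> (xs - ys) = 0" by (intro weak_null[OF G(1)])
  have "ls \<odot> xs = 0" using ip_null_diff[OF eq, of ls] ls[OF ys] by (simp add: ip_commute)

  \<comment> \<open>The part of \<open>xt_var'\<close> that vanishes in norm; it may therefore be
    paired with vectors that are merely bounded.\<close>
  define e where "e k = a *\<^sub>R dx k - \<zeta> k + \<beta> *\<^sub>R dy k" for k
  have e: "((\<lambda>k. e k \<odot> e k) \<longlongrightarrow> 0) G"
  proof (rule tendsto_sandwich[OF _ _ tendsto_const])
    have "((\<lambda>k. (4 * a\<^sup>2 + 4 * (L + \<beta>)\<^sup>2) * (dx k \<odot> dx k) + 2 * \<beta>\<^sup>2 * (dy k \<odot> dy k))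
        \<longlongrightarrow> (4 * a\<^sup>2 + 4 * (L + \<beta>)\<^sup>2) * 0 + 2 * \<beta>\<^sup>2 * 0) G"
      by (intro tendsto_intros van)
    then show "((\<lambda>k. (4 * a\<^sup>2 + 4 * (L + \<beta>)\<^sup>2) * (dx k \<odot> dx k) + 2 * \<beta>\<^sup>2 * (dy k \<odot> dy k)) \<longlongrightarrow> 0) G"
      by simp
    show "\<forall>\<^sub>F k in G. e k \<odot> e k \<le> (4 * a\<^sup>2 + 4 * (L + \<beta>)\<^sup>2) * (dx k \<odot> dx k) + 2 * \<beta>\<^sup>2 * (dy k \<odot> dy k)"
    proof (intro always_eventually allI)
      fix k
      define m where "m = dx k \<odot> dx k"
      have "e k \<odot> e k \<le> 2 * ((a *\<^sub>R dx k - \<zeta> k) \<odot> (a *\<^sub>R dx k - \<zeta> k))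
          + 2 * ((\<beta> *\<^sub>R dy k) \<odot> (\<beta> *\<^sub>R dy k))"
        unfolding e_def by (rule sq_add_le)
      moreover have "(a *\<^sub>R dx k - \<zeta> k) \<odot> (a *\<^sub>R dx k - \<zeta> k) \<le> 2 * (a\<^sup>2 * m) + 2 * (\<zeta> k \<odot> \<zeta> k)"
        using sq_add_le[of "a *\<^sub>R dx k" "- \<zeta> k"] by (simp add: m_def power2_eq_square mult.assoc mult.left_commute)
      moreover have "\<zeta> k \<odot> \<zeta> k \<le> (L + \<beta>)\<^sup>2 * m" unfolding m_def by (rule sq_\<zeta>)
      moreover have "(\<beta> *\<^sub>R dy k) \<odot> (\<beta> *\<^sub>R dy k) = \<beta>\<^sup>2 * (dy k \<odot> dy k)"
        by (simp add: power2_eq_square)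
      ultimately have "e k \<odot> e k \<le> 4 * (a\<^sup>2 * m) + 4 * ((L + \<beta>)\<^sup>2 * m) + 2 * (\<beta>\<^sup>2 * (dy k \<odot> dy k))"
        by linarith
      then show "e k \<odot> e k \<le> (4 * a\<^sup>2 + 4 * (L + \<beta>)\<^sup>2) * (dx k \<odot> dx k) + 2 * \<beta>\<^sup>2 * (dy k \<odot> dy k)"
        unfolding m_def[symmetric] by (simp only: distrib_right mult.assoc)
    qed
  qed simp
  have small: "\<forall>\<^sub>F k in G. dx k \<odot> dx k \<le> 1"
    using order_tendstoD(2)[OF van(1), of 1] by (auto elim!: eventually_mono)
  \<comment> \<open>Writing \<open>lt k\<close> as \<open>l k - dl k\<close> reduces the claim to a
    norm-null sequence paired with a bounded one.\<close>
  have "((\<lambda>k. dl k \<odot> l k - dl k \<odot> dl k) \<longlongrightarrow> 0 - 0) G"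
    by (intro tendsto_diff van(3)) (rule tendsto_ip_null[OF van(3) always_eventually[OF allI[OF B(3)]]])
  then have llt: "((\<lambda>k. dl k \<odot> lt k) \<longlongrightarrow> 0) G" by (simp add: ip_diff_right)
  have minty: "0 \<le> (F u - ls) \<odot> (u - xs)" if u: "u \<in> C" for u
  proof -
    have "((\<lambda>k. e k \<odot> (u - x k) + e k \<odot> dx k) \<longlongrightarrow> 0 + 0) G"
    proof (intro tendsto_add tendsto_ip_null[OF e])
      show "\<forall>\<^sub>F k in G. (u - x k) \<odot> (u - x k) \<le> 2 * (u \<odot> u) + 2 * B"
      proof (intro always_eventually allI)
        fix k show "(u - x k) \<odot> (u - x k) \<le> 2 * (u \<odot> u) + 2 * B"
          using sq_add_le[of u "- x k"] B(1)[of k] by simp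
      qed
    qed (rule small)
    then have lim: "((\<lambda>k. e k \<odot> (u - xt k)) \<longlongrightarrow> 0) G" by (simp add: ip_diff_right)
    have "((\<lambda>k. F u \<odot> u - xt k \<odot> F u - lt k \<odot> u + (1 / \<beta>) * (dl k \<odot> lt k))
        \<longlongrightarrow> F u \<odot> u - xs \<odot> F u - ls \<odot> u + (1 / \<beta>) * 0) G"
      by (intro tendsto_intros llt weak_tendstoD[OF xt] weak_tendstoD[OF lt'])
    \<comment> \<open>Monotonicity replaces F at \<open>xt k\<close> by F at the fixed
      \<open>u\<close>, and orthogonality of \<open>lt k\<close> to \<open>yt k\<close> trades the
      product of \<open>lt k\<close> and \<open>xt k\<close> for one with \<open>dl k\<close>. The
      remaining pairings are with fixed vectors.\<close>
    moreover have "e k \<odot> (u - xt k) \<le> F u \<odot> u - xt k \<odot> F u - lt k \<odot> u + (1 / \<beta>) * (dl k \<odot> lt k)" for k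
    proof -
      have "(e k - F (xt k) + lt k) \<odot> (u - xt k) \<le> 0" unfolding e_def by (rule xt_var'[OF u])
      moreover have "0 \<le> (F u - F (xt k)) \<odot> (u - xt k)" by (rule F_mono)
      ultimately have "e k \<odot> (u - xt k) \<le> F u \<odot> u - xt k \<odot> F u - lt k \<odot> u + lt k \<odot> xt k"
        by (simp add: ip_simps ip_commute)
      also have "lt k \<odot> xt k = (1 / \<beta>) * (dl k \<odot> lt k)"
        using \<beta> lt_orth[OF yt_in, of k k]
        by (simp add: dl_eq ip_commute[of "xt k - yt k"] ip_diff_right)
      finally show ?thesis .
    qed
    ultimately have "0 \<le> F u \<odot> u - xs \<odot> F u - ls \<odot> u + (1 / \<beta>) * 0"
      by (intro tendsto_le[OF G(1) _ lim]) auto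
    with \<open>ls \<odot> xs = 0\<close> show ?thesis by (simp add: ip_simps ip_commute)
  qed
  show ?thesis unfolding sol_def using xs ys eq ls Minty[OF xs minty] by blast
qed

text \<open>Compactness is applied to the three components in turn, each time refining the previous
  filter; weak limits already found survive refinement.\<close>

lemma weak_cluster_exists:
  assumes "sol x0 y0 l0" "G \<noteq> bot" "G \<le> sequentially"
  obtains G' xs ys ls where "G' \<le> G" "G' \<noteq> bot" "sol xs ys ls"
    "weak_tendsto x xs G'" "weak_tendsto y ys G'" "weak_tendsto l ls G'"
proof -
  obtain B where B: "\<And>k. x k \<odot> x k \<le> B" "\<And>k. y k \<odot> y k \<le> B" "\<And>k. l k \<odot> l k \<le> B"
    using iterates_bounded[OF assms(1)] by metis
  obtain G1 xs where 1: "G1 \<le> G" "G1 \<noteq> bot" "weak_tendsto x xs G1"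
    using weak_compact[where X = x, OF B(1) assms(2)] by blast
  obtain G2 ys where 2: "G2 \<le> G1" "G2 \<noteq> bot" "weak_tendsto y ys G2"
    using weak_compact[where X = y, OF B(2) 1(2)] by blast
  obtain G3 ls where 3: "G3 \<le> G2" "G3 \<noteq> bot" "weak_tendsto l ls G3"
    using weak_compact[where X = l, OF B(3) 2(2)] by blast
  have "weak_tendsto x xs G3" "weak_tendsto y ys G3"
    by (rule weak_tendsto_mono[OF 1(3) order_trans[OF 3(1) 2(1)]])
      (rule weak_tendsto_mono[OF 2(3) 3(1)])
  moreover have "G3 \<le> G" using 1 2 3 by order
  ultimately show ?thesis
    using weak_cluster_sol[OF assms(1) 3(2) order_trans[OF _ assms(3)]] 3(2,3) by (intro that) auto
qed

text \<open>
  Opial's argument: the difference \<open>V s - V s'\<close> of the Lyapunov functions of two solutions is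
  affine in the iterate, so its limit determines the distance between two weak cluster points.
\<close>

lemma weak_cluster_unique:
  assumes s: "sol xs ys ls" and s': "sol xs' ys' ls'"
    and G: "G \<noteq> bot" "G \<le> sequentially" and G': "G' \<noteq> bot" "G' \<le> sequentially"
    and w: "weak_tendsto x xs G" "weak_tendsto y ys G" "weak_tendsto l ls G"
    and w': "weak_tendsto x xs' G'" "weak_tendsto y ys' G'" "weak_tendsto l ls' G'"
  shows "(xs - xs') \<odot> (xs - xs') = 0"
proof -
  define \<delta>x \<delta>y \<delta>l where "\<delta>x = xs - xs'" and "\<delta>y = ys - ys'" and "\<delta>l = ls - ls'"
  define J where "J p q s = a * (p \<odot> \<delta>x) + \<beta> * (q \<odot> \<delta>y) + (1 / \<beta>) * (s \<odot> \<delta>l)" for p q s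
  define c where "c = a * (xs \<odot> xs - xs' \<odot> xs') + \<beta> * (ys \<odot> ys - ys' \<odot> ys')
    + (1 / \<beta>) * (ls \<odot> ls - ls' \<odot> ls')"
  have J: "J (x k) (y k) (l k) = (V xs' ys' ls' k - V xs ys ls k + c) / 2" for k
    unfolding V_def J_def c_def sq_diff \<delta>x_def \<delta>y_def \<delta>l_def
    unfolding ip_diff_right by (simp add: right_diff_distrib distrib_left add_divide_distrib diff_divide_distrib)
  obtain v v' where "V xs ys ls \<longlonglongrightarrow> v" "V xs' ys' ls' \<longlonglongrightarrow> v'"
    using V_converges[OF s] V_converges[OF s'] by (auto simp: convergent_def)
  then have lim: "(\<lambda>k. J (x k) (y k) (l k)) \<longlonglongrightarrow> (v' - v + c) / 2"
    unfolding J by (intro tendsto_intros) auto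
  have weak: "((\<lambda>k. J (x k) (y k) (l k)) \<longlongrightarrow> J p q u) H"
    if "weak_tendsto x p H" "weak_tendsto y q H" "weak_tendsto l u H" for p q u H
    unfolding J_def by (intro tendsto_intros weak_tendstoD that)
  have "J xs ys ls = J xs' ys' ls'"
    using tendsto_unique[OF G(1) weak[OF w] tendsto_mono[OF G(2) lim]]
      tendsto_unique[OF G'(1) weak[OF w'] tendsto_mono[OF G'(2) lim]] by simp
  \<comment> \<open>By bilinearity, the difference of \<open>J\<close> at the two cluster points is
    their weighted squared distance.\<close>
  then have "a * (\<delta>x \<odot> \<delta>x) + \<beta> * (\<delta>y \<odot> \<delta>y) + (1 / \<beta>) * (\<delta>l \<odot> \<delta>l) = 0"
    unfolding J_def \<delta>x_def \<delta>y_def \<delta>l_def ip_diff_left by (simp add: right_diff_distrib)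
  moreover have "0 \<le> a * (\<delta>x \<odot> \<delta>x)" "0 \<le> \<beta> * (\<delta>y \<odot> \<delta>y)" "0 \<le> (1 / \<beta>) * (\<delta>l \<odot> \<delta>l)"
    using \<beta> r_pos by auto
  ultimately have "a * (\<delta>x \<odot> \<delta>x) = 0" by linarith
  then show ?thesis using \<beta> r_pos by (simp add: \<delta>x_def)
qed

lemma weak_convergence:
  assumes ex: "sol x0 y0 l0"
  obtains xs where "xs \<in> C" "xs \<in> N" "\<And>u. u \<in> C \<Longrightarrow> u \<in> N \<Longrightarrow> 0 \<le> F xs \<odot> (u - xs)"
    "weak_tendsto x xs sequentially"
proof -
  obtain G xs ys ls where G: "G \<le> sequentially" "G \<noteq> bot" "sol xs ys ls"
    and w: "weak_tendsto x xs G" "weak_tendsto y ys G" "weak_tendsto l ls G"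
    using weak_cluster_exists[OF ex sequentially_bot order_refl] by blast
  have "weak_tendsto x xs sequentially"
    unfolding weak_tendsto_def tendsto_iff
  proof (intro allI impI, rule ccontr)
    fix v and e :: real assume "e > 0" "\<not> (\<forall>\<^sub>F k in sequentially. dist (x k \<odot> v) (xs \<odot> v) < e)"
    \<comment> \<open>If convergence fails for \<open>v\<close>, the bad indices are not eventually
      avoided, so restricting to them gives a proper filter. A cluster point along it must agree
      with \<open>xs\<close>, contradicting the gap \<open>e\<close>.\<close>
    define H where "H = inf sequentially (principal {k. \<not> dist (x k \<odot> v) (xs \<odot> v) < e})"
    have "H \<noteq> bot"
      using \<open>\<not> eventually _ _\<close> unfolding H_def trivial_limit_def eventually_inf_principal by simp
    moreover have "H \<le> sequentially" by (simp add: H_def)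
    ultimately obtain G' xs' ys' ls' where G': "G' \<le> H" "G' \<noteq> bot" "sol xs' ys' ls'"
      and w': "weak_tendsto x xs' G'" "weak_tendsto y ys' G'" "weak_tendsto l ls' G'"
      using weak_cluster_exists[OF ex] by blast
    have "G' \<le> sequentially" using G'(1) \<open>H \<le> sequentially\<close> by order
    from weak_cluster_unique[OF G(3) G'(3) G(2,1) G'(2) this w w']
    have "xs \<odot> v = xs' \<odot> v" by (rule ip_null_diff)
    with weak_tendstoD[OF w'(1), of v] \<open>e > 0\<close>
    have "\<forall>\<^sub>F k in G'. dist (x k \<odot> v) (xs \<odot> v) < e" by (auto simp: tendsto_iff)
    moreover have "\<forall>\<^sub>F k in H. \<not> dist (x k \<odot> v) (xs \<odot> v) < e"
      unfolding H_def eventually_inf_principal by simp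
    then have "\<forall>\<^sub>F k in G'. \<not> dist (x k \<odot> v) (xs \<odot> v) < e" by (rule filter_leD[OF G'(1)])
    ultimately have "\<forall>\<^sub>F k in G'. False" by eventually_elim simp
    with G'(2) show False by (simp add: trivial_limit_def)
  qed
  moreover have xs: "xs \<in> C" "xs \<in> N" and orth: "\<And>v. v \<in> N \<Longrightarrow> ls \<odot> v = 0"
    and vi: "\<And>u. u \<in> C \<Longrightarrow> 0 \<le> (F xs - ls) \<odot> (u - xs)"
    using G(3) closed_ip_null[OF N(2), of ys xs] unfolding sol_def by (auto simp: sq_diff_commute)
  \<comment> \<open>For \<open>u\<close> in \<open>N\<close> the multiplier drops out, since it is
    orthogonal to both \<open>u\<close> and \<open>xs\<close>.\<close>
  have "0 \<le> F xs \<odot> (u - xs)" if "u \<in> C" "u \<in> N" for u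
    using vi[OF that(1)] orth[OF that(2)] orth[OF xs(2)] by (simp add: ip_simps)
  ultimately show ?thesis using that xs by blast
qed

end

section \<open>Square-integrable random vectors\<close>

text \<open>Pointwise scaling, together with the pointwise addition of functions, makes the whole
  function type a real vector space, so that the abstract locales and the notions of subspace and
  linear map apply to random vectors.\<close>

instantiation "fun" :: (type, scaleR) scaleR
begin

definition scaleR_fun_def: "c *\<^sub>R f = (\<lambda>x. c *\<^sub>R f x)"

instance ..

end

lemma scaleR_fun_apply [simp]: "(c *\<^sub>R f) x = c *\<^sub>R f x"
  by (simp add: scaleR_fun_def)

instance "fun" :: (type, real_vector) real_vector
  by standard (simp_all add: fun_eq_iff algebra_simps)

section \<open>The carrier \<open>L2 M\<close> and its completeness\<close>

lemma L2_zero: "0 \<in> L2 M"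
  by (simp add: L2_def zero_fun_def)

lemma L2_add:
  fixes f g :: "'w \<Rightarrow> real^'n::finite"
  assumes "f \<in> L2 M" "g \<in> L2 M"
  shows "f + g \<in> L2 M"
proof -
  have m [measurable]: "f \<in> borel_measurable M" "g \<in> borel_measurable M"
    using assms by (auto simp: L2_def)
  have "integrable M (\<lambda>\<omega>. 2 * (norm (f \<omega>))\<^sup>2 + 2 * (norm (g \<omega>))\<^sup>2)"
    using assms by (auto simp: L2_def)
  moreover have "(\<lambda>\<omega>. (norm (f \<omega> + g \<omega>))\<^sup>2) \<in> borel_measurable M" by measurable
  moreover have "AE \<omega> in M. norm ((norm (f \<omega> + g \<omega>))\<^sup>2) \<le> norm (2 * (norm (f \<omega>))\<^sup>2 + 2 * (norm (g \<omega>))\<^sup>2)"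
  proof (rule AE_I2)
    fix \<omega>
    have "(norm (f \<omega> + g \<omega>))\<^sup>2 \<le> (norm (f \<omega>) + norm (g \<omega>))\<^sup>2"
      by (intro power_mono norm_triangle_ineq) simp
    also have "\<dots> \<le> 2 * (norm (f \<omega>))\<^sup>2 + 2 * (norm (g \<omega>))\<^sup>2"
      using zero_le_power2[of "norm (f \<omega>) - norm (g \<omega>)"] by (simp add: power2_sum power2_diff)
    finally show "norm ((norm (f \<omega> + g \<omega>))\<^sup>2) \<le> norm (2 * (norm (f \<omega>))\<^sup>2 + 2 * (norm (g \<omega>))\<^sup>2)"
      by simp
  qed
  ultimately have "integrable M (\<lambda>\<omega>. (norm (f \<omega> + g \<omega>))\<^sup>2)"
    by (rule Bochner_Integration.integrable_bound)
  then show ?thesis by (simp add: L2_def plus_fun_def)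
qed

lemma L2_scaleR: "f \<in> L2 M \<Longrightarrow> c *\<^sub>R f \<in> L2 M"
  by (auto simp: L2_def scaleR_fun_def power_mult_distrib)

lemma subspace_L2: "subspace (L2 M)"
  by (simp add: subspace_def L2_zero L2_add L2_scaleR)

lemma L2_uminus: "f \<in> L2 M \<Longrightarrow> - f \<in> L2 M"
  by (rule subspace_neg[OF subspace_L2])

lemma L2_diff: "f \<in> L2 M \<Longrightarrow> g \<in> L2 M \<Longrightarrow> f - g \<in> L2 M"
  by (rule subspace_diff[OF subspace_L2])

lemma L2_integrable_inner:
  assumes "f \<in> L2 M" "g \<in> L2 M"
  shows "integrable M (\<lambda>\<omega>. f \<omega> \<bullet> g \<omega>)"
proof (rule Bochner_Integration.integrable_bound)
  show "integrable M (\<lambda>\<omega>. (norm (f \<omega>))\<^sup>2 + (norm (g \<omega>))\<^sup>2)"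
    using assms by (auto simp: L2_def)
  show "(\<lambda>\<omega>. f \<omega> \<bullet> g \<omega>) \<in> borel_measurable M" using assms by (auto simp: L2_def)
  show "AE \<omega> in M. norm (f \<omega> \<bullet> g \<omega>) \<le> norm ((norm (f \<omega>))\<^sup>2 + (norm (g \<omega>))\<^sup>2)"
  proof (rule AE_I2)
    fix \<omega>
    have "\<bar>f \<omega> \<bullet> g \<omega>\<bar> \<le> norm (f \<omega>) * norm (g \<omega>)" by (rule Cauchy_Schwarz_ineq2)
    also have "\<dots> \<le> (norm (f \<omega>))\<^sup>2 + (norm (g \<omega>))\<^sup>2"
      using sum_squares_bound[of "norm (f \<omega>)" "norm (g \<omega>)"]
        mult_nonneg_nonneg[OF norm_ge_zero[of "f \<omega>"] norm_ge_zero[of "g \<omega>"]] by linarith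
    finally show "norm (f \<omega> \<bullet> g \<omega>) \<le> norm ((norm (f \<omega>))\<^sup>2 + (norm (g \<omega>))\<^sup>2)" by simp
  qed
qed

lemma L2_inner_self: "L2_inner M f f = (\<integral>\<omega>. (norm (f \<omega>))\<^sup>2 \<partial>M)"
  by (simp add: L2_inner_def power2_norm_eq_inner)

lemma L2_norm_sq: "(L2_norm M f)\<^sup>2 = L2_inner M f f"
  unfolding L2_norm_def L2_inner_self by simp

text \<open>The limit is required to lie in \<open>L2 M\<close> because the integral of a
  non-integrable function is 0 by convention, so \<open>L2_inner\<close> alone could report a
  spurious convergence.\<close>

definition L2_closed :: "'w measure \<Rightarrow> ('w \<Rightarrow> real^'n::finite) set \<Rightarrow> bool" where
  "L2_closed M S \<longleftrightarrow> (\<forall>X l. (\<forall>n::nat. X n \<in> S) \<longrightarrow> l \<in> L2 M \<longrightarrow>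
     (\<lambda>n. L2_inner M (X n - l) (X n - l)) \<longlonglongrightarrow> 0 \<longrightarrow> l \<in> S)"

text \<open>Norm convergence is convergence in mean of the squared distances, which gives a.e.
  convergence along a subsequence. Pointwise constraints pass to norm limits this way.\<close>

lemma L2_AE_subsequence:
  assumes X: "\<And>n. X n \<in> L2 M" and l: "l \<in> L2 M"
    and lim: "(\<lambda>n. L2_inner M (X n - l) (X n - l)) \<longlonglongrightarrow> 0"
  shows "\<exists>r::nat\<Rightarrow>nat. strict_mono r \<and> (AE \<omega> in M. (\<lambda>n. X (r n) \<omega>) \<longlonglongrightarrow> l \<omega>)"
proof -
  have "\<exists>r::nat\<Rightarrow>nat. strict_mono r \<and> (AE \<omega> in M. (\<lambda>n. (norm (X (r n) \<omega> - l \<omega>))\<^sup>2) \<longlonglongrightarrow> 0)"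
  proof (rule tendsto_L1_AE_subseq)
    show "integrable M (\<lambda>\<omega>. (norm (X n \<omega> - l \<omega>))\<^sup>2)" for n
      using L2_diff[OF X l, of n] by (simp add: L2_def)
    show "(\<lambda>n. \<integral>\<omega>. norm ((norm (X n \<omega> - l \<omega>))\<^sup>2) \<partial>M) \<longlonglongrightarrow> 0"
      using lim by (simp add: L2_inner_self)
  qed
  moreover have "Y \<longlonglongrightarrow> y" if "(\<lambda>n. (norm (Y n - y))\<^sup>2) \<longlonglongrightarrow> 0" for Y :: "nat \<Rightarrow> real^'n" and y
    using that by (simp add: LIM_zero_iff tendsto_norm_zero_iff)
  ultimately show ?thesis by (elim exE conjE) (intro exI conjI, assumption, auto elim!: eventually_mono)
qed

text \<open>The Riesz-Fischer argument: rapidly approaching members have a.e. summable increments,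
  and Fatou's lemma shows that their pointwise limit is also the norm limit.\<close>

lemma (in prob_space) L2_complete:
  fixes X :: "nat \<Rightarrow> 'a \<Rightarrow> real^'n::finite"
  assumes X: "\<And>n. X n \<in> L2 M"
    and Cauchy: "\<forall>e>0. \<exists>K. \<forall>m\<ge>K. \<forall>n\<ge>K. L2_inner M (X m - X n) (X m - X n) < e"
  shows "\<exists>l\<in>L2 M. (\<lambda>n. L2_inner M (X n - l) (X n - l)) \<longlonglongrightarrow> 0"
proof -
  have meas [measurable]: "X n \<in> borel_measurable M" for n using X[of n] by (simp add: L2_def)
  have int2: "integrable M (\<lambda>\<omega>. (norm (X m \<omega> - X n \<omega>))\<^sup>2)" for m n
    using L2_diff[OF X X, of m n] by (simp add: L2_def)
  have "\<exists>K. \<forall>m\<ge>K. \<forall>n\<ge>K. L2_inner M (X m - X n) (X m - X n) < (1/4)^k" for k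
    using Cauchy by simp
  then obtain K where K: "\<And>k m n. m \<ge> K k \<Longrightarrow> n \<ge> K k \<Longrightarrow> L2_inner M (X m - X n) (X m - X n) < (1/4)^k"
    by metis
  \<comment> \<open>Partial sums make the indices nondecreasing while staying above the thresholds
    \<open>K k\<close>.\<close>
  define r where "r k = (\<Sum>j\<le>k. K j)" for k
  have rK: "K k \<le> r k" for k unfolding r_def by (rule member_le_sum) auto
  have r_mono: "r k \<le> r (Suc k)" for k by (simp add: r_def)
  define g where "g k \<omega> = norm (X (r (Suc k)) \<omega> - X (r k) \<omega>)" for k \<omega>
  have g_int: "(\<integral>\<^sup>+\<omega>. g k \<omega> \<partial>M) \<le> ennreal ((1/2)^k)" for k
  proof -
    \<comment> \<open>The arithmetic-geometric mean inequality with weight \<open>2^k\<close> bounds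
      the mean of \<open>g k\<close> through its second moment, which is at most
      \<open>(1/4)^k\<close>; the constant term integrates to itself because the total mass is
      1.\<close>
    have "g k \<omega> \<le> (2^k * (g k \<omega>)\<^sup>2 + (1/2)^k) / 2" for \<omega>
    proof -
      have "0 \<le> (2^k * g k \<omega> - 1)\<^sup>2" by simp
      also have "\<dots> = 2^k * (2^k * (g k \<omega>)\<^sup>2 + (1/2)^k - 2 * g k \<omega>)"
        by (simp add: power2_eq_square algebra_simps power_divide flip: power_mult_distrib)
      finally have "0 \<le> 2^k * (g k \<omega>)\<^sup>2 + (1/2)^k - 2 * g k \<omega>"
        by (metis zero_le_mult_iff not_le zero_less_power zero_less_numeral)
      then show ?thesis by simp
    qed
    then have "(\<integral>\<^sup>+\<omega>. g k \<omega> \<partial>M) \<le> (\<integral>\<^sup>+\<omega>. ennreal ((2^k * (g k \<omega>)\<^sup>2 + (1/2)^k) / 2) \<partial>M)"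
      by (intro nn_integral_mono ennreal_leI)
    also have "\<dots> = ennreal (\<integral>\<omega>. (2^k * (g k \<omega>)\<^sup>2 + (1/2)^k) / 2 \<partial>M)"
      using int2 by (intro nn_integral_eq_integral) (auto simp: g_def)
    also have "(\<integral>\<omega>. (2^k * (g k \<omega>)\<^sup>2 + (1/2)^k) / 2 \<partial>M) = (2^k * (\<integral>\<omega>. (g k \<omega>)\<^sup>2 \<partial>M) + (1/2)^k) / 2"
      using int2 by (simp add: g_def prob_space)
    also have "(\<integral>\<omega>. (g k \<omega>)\<^sup>2 \<partial>M) = L2_inner M (X (r (Suc k)) - X (r k)) (X (r (Suc k)) - X (r k))"
      by (simp add: L2_inner_self g_def)
    also have "\<dots> \<le> (1/4)^k"
      using K[OF order_trans[OF rK r_mono] rK] by (rule less_imp_le)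
    also have "(2^k * (1/4)^k + (1/2)^k) / 2 = ((1/2)^k :: real)"
      by (simp flip: power_mult_distrib)
    finally show ?thesis by (simp add: ennreal_leI divide_right_mono)
  qed
  have "(\<integral>\<^sup>+\<omega>. (\<Sum>k. ennreal (g k \<omega>)) \<partial>M) = (\<Sum>k. \<integral>\<^sup>+\<omega>. g k \<omega> \<partial>M)"
    by (intro nn_integral_suminf) (simp add: g_def)
  also have "\<dots> \<le> (\<Sum>k. ennreal ((1/2)^k))" by (intro suminf_le g_int summableI)
  also have "\<dots> = ennreal (\<Sum>k. (1/2)^k)" by (intro suminf_ennreal2) (auto intro: summable_geometric)
  also have "\<dots> < \<infinity>" by simp
  finally have "AE \<omega> in M. (\<Sum>k. ennreal (g k \<omega>)) \<noteq> \<infinity>"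
    by (intro nn_integral_PInf_AE) (auto simp: g_def)
  then have conv: "AE \<omega> in M. (\<lambda>k. X (r k) \<omega>) \<longlonglongrightarrow> lim (\<lambda>k. X (r k) \<omega>)"
  proof eventually_elim
    case (elim \<omega>)
    then have "summable (\<lambda>k. g k \<omega>)"
      by (intro summable_suminf_not_top) (auto simp: g_def)
    then have "summable (\<lambda>k. X (r (Suc k)) \<omega> - X (r k) \<omega>)"
      unfolding g_def by (rule summable_norm_cancel)
    then obtain s where "(\<lambda>n. \<Sum>k<n. X (r (Suc k)) \<omega> - X (r k) \<omega>) \<longlonglongrightarrow> s"
      unfolding summable_def sums_def by blast
    then have "(\<lambda>n. X (r n) \<omega> - X (r 0) \<omega>) \<longlonglongrightarrow> s"
      using sum_lessThan_telescope[of "\<lambda>k. X (r k) \<omega>"] by simp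
    from tendsto_add[OF this tendsto_const[of "X (r 0) \<omega>"]]
    show ?case by (simp add: convergent_def convergent_LIMSEQ_iff[symmetric] exI)
  qed
  define l where "l \<omega> = lim (\<lambda>k. X (r k) \<omega>)" for \<omega>
  have [measurable]: "l \<in> borel_measurable M" unfolding l_def by measurable
  \<comment> \<open>Fixing \<open>n\<close> and applying Fatou's lemma in \<open>j\<close> controls
    the full sequence, and not only the members \<open>X (r j)\<close>.\<close>
  have Fatou: "(\<integral>\<^sup>+\<omega>. ennreal ((norm (X n \<omega> - l \<omega>))\<^sup>2) \<partial>M) \<le> ennreal ((1/4)^k)" if n: "n \<ge> K k" for n k
  proof -
    have "(\<integral>\<^sup>+\<omega>. ennreal ((norm (X n \<omega> - l \<omega>))\<^sup>2) \<partial>M)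
        = (\<integral>\<^sup>+\<omega>. liminf (\<lambda>j. ennreal ((norm (X n \<omega> - X (r j) \<omega>))\<^sup>2)) \<partial>M)"
    proof (rule nn_integral_cong_AE)
      show "AE \<omega> in M. ennreal ((norm (X n \<omega> - l \<omega>))\<^sup>2)
          = liminf (\<lambda>j. ennreal ((norm (X n \<omega> - X (r j) \<omega>))\<^sup>2))"
        using conv
      proof eventually_elim
        case (elim \<omega>)
        then show ?case
          by (intro lim_imp_Liminf[symmetric] tendsto_ennrealI tendsto_intros) (auto simp: l_def)
      qed
    qed
    also have "\<dots> \<le> liminf (\<lambda>j. \<integral>\<^sup>+\<omega>. ennreal ((norm (X n \<omega> - X (r j) \<omega>))\<^sup>2) \<partial>M)"
      by (intro nn_integral_liminf) measurable
    also have "\<dots> \<le> ennreal ((1/4)^k)"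
    proof (rule Liminf_le)
      show "\<forall>\<^sub>F j in sequentially. (\<integral>\<^sup>+\<omega>. ennreal ((norm (X n \<omega> - X (r j) \<omega>))\<^sup>2) \<partial>M) \<le> ennreal ((1/4)^k)"
        using eventually_ge_at_top[of k]
      proof eventually_elim
        case (elim j)
        have "K k \<le> r j" using rK[of k] lift_Suc_mono_le[of r, OF r_mono elim] by simp
        with K[OF n this] show ?case
          by (simp add: nn_integral_eq_integral[OF int2] L2_inner_self ennreal_leI)
      qed
    qed simp
    finally show ?thesis .
  qed
  have diff: "X n - l \<in> L2 M" "L2_inner M (X n - l) (X n - l) \<le> (1/4)^k" if n: "n \<ge> K k" for n k
  proof -
    have fin: "(\<integral>\<^sup>+\<omega>. ennreal ((norm (X n \<omega> - l \<omega>))\<^sup>2) \<partial>M) < \<infinity>"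
      using Fatou[OF n] by (rule le_less_trans) simp
    then have int: "integrable M (\<lambda>\<omega>. (norm (X n \<omega> - l \<omega>))\<^sup>2)"
      by (intro integrableI_bounded) auto
    then show "X n - l \<in> L2 M" by (simp add: L2_def fun_diff_def)
    show "L2_inner M (X n - l) (X n - l) \<le> (1/4)^k"
      using Fatou[OF n] unfolding nn_integral_eq_integral[OF int AE_I2[OF zero_le_power2]]
      by (simp add: L2_inner_self)
  qed
  have "X (K 0) - (X (K 0) - l) \<in> L2 M" by (rule L2_diff[OF X diff(1)[OF order_refl]])
  then have "l \<in> L2 M" by (simp add: fun_diff_def)
  moreover have "(\<lambda>n. L2_inner M (X n - l) (X n - l)) \<longlonglongrightarrow> 0"
  proof (rule LIMSEQ_I)
    fix e :: real assume "e > 0"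
    then obtain k where k: "(1/4)^k < e" using real_arch_pow_inv[of e "1/4"] by auto
    have "norm (L2_inner M (X n - l) (X n - l) - 0) < e" if "n \<ge> K k" for n
      using diff(2)[OF that] k by (simp add: L2_inner_self)
    then show "\<exists>no. \<forall>n\<ge>no. norm (L2_inner M (X n - l) (X n - l) - 0) < e" by blast
  qed
  ultimately show ?thesis by blast
qed

lemma L2_inner_commute: "L2_inner M f g = L2_inner M g f"
  by (simp add: L2_inner_def inner_commute)

lemma L2_inner_add:
  "f \<in> L2 M \<Longrightarrow> g \<in> L2 M \<Longrightarrow> h \<in> L2 M \<Longrightarrow> L2_inner M (f + g) h = L2_inner M f h + L2_inner M g h"
  by (simp add: L2_inner_def inner_add_left L2_integrable_inner)

text \<open>
  Extending the inner product along a linear retraction \<open>p\<close> of all functions onto \<open>L2 M\<close> makes it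
  total; this frees the Hilbert space argument from carrier conditions.
\<close>

definition L2_retraction :: "'w measure \<Rightarrow> (('w \<Rightarrow> real^'n::finite) \<Rightarrow> ('w \<Rightarrow> real^'n)) \<Rightarrow> bool" where
  "L2_retraction M p \<longleftrightarrow> linear p \<and> (\<forall>f. p f \<in> L2 M) \<and> (\<forall>f\<in>L2 M. p f = f)"

lemma L2_retractionD:
  assumes "L2_retraction M p"
  shows "linear p" "p f \<in> L2 M" "f \<in> L2 M \<Longrightarrow> p f = f"
  using assms by (auto simp: L2_retraction_def)

text \<open>This is pure linear algebra: the retraction is a linear left inverse of the identity on
  the subspace \<open>L2 M\<close>.\<close>

lemma L2_retraction_exists: "\<exists>p :: ('w \<Rightarrow> real^'n::finite) \<Rightarrow> ('w \<Rightarrow> real^'n). L2_retraction M p"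
proof -
  obtain p :: "('w \<Rightarrow> real^'n) \<Rightarrow> ('w \<Rightarrow> real^'n)"
    where "range p \<subseteq> L2 M" "linear p" "\<forall>f\<in>L2 M. p (id f) = f"
    using linear_exists_left_inverse_on[OF linear_id subspace_L2 inj_on_id] by blast
  then show ?thesis by (auto simp: L2_retraction_def)
qed

lemma (in prob_space) semi_hilbert_L2:
  fixes p :: "('a \<Rightarrow> real^'n::finite) \<Rightarrow> ('a \<Rightarrow> real^'n)"
  assumes "L2_retraction M p"
  shows "semi_hilbert (\<lambda>f g. L2_inner M (p f) (p g))"
proof
  note p_in = L2_retractionD(2)[OF assms] and p_id = L2_retractionD(3)[OF assms]
  interpret linear p by (rule L2_retractionD(1)[OF assms])
  fix f g h :: "'a \<Rightarrow> real^'n" and c :: real and X :: "nat \<Rightarrow> 'a \<Rightarrow> real^'n"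
  show "L2_inner M (p f) (p g) = L2_inner M (p g) (p f)" by (rule L2_inner_commute)
  show "L2_inner M (p (f + g)) (p h) = L2_inner M (p f) (p h) + L2_inner M (p g) (p h)"
    by (simp add: add L2_inner_add p_in)
  show "L2_inner M (p (c *\<^sub>R f)) (p g) = c * L2_inner M (p f) (p g)"
    by (simp add: scale L2_inner_def)
  show "0 \<le> L2_inner M (p f) (p f)" by (simp add: L2_inner_self)
  assume "\<forall>e>0. \<exists>K. \<forall>m\<ge>K. \<forall>n\<ge>K. L2_inner M (p (X m - X n)) (p (X m - X n)) < e"
  then obtain l where "l \<in> L2 M" "(\<lambda>n. L2_inner M (p (X n) - l) (p (X n) - l)) \<longlonglongrightarrow> 0"
    using L2_complete[of "\<lambda>n. p (X n)"] by (auto simp: p_in diff)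
  then show "\<exists>l. (\<lambda>n. L2_inner M (p (X n - l)) (p (X n - l))) \<longlonglongrightarrow> 0"
    by (intro exI[of _ l]) (simp add: diff p_id)
qed

section \<open>Convexity and closedness of the two feasible sets\<close>

lemma linear_block: "linear (block stage i)"
  by (rule linearI) (auto simp: block_def vec_eq_iff)

lemma tendsto_block: "(X \<longlongrightarrow> v) G \<Longrightarrow> ((\<lambda>k. block stage i (X k)) \<longlongrightarrow> block stage i v) G"
  using bounded_linear.tendsto[OF linear_conv_bounded_linear[THEN iffD1, OF linear_block]] .

lemma convex_constraint_set:
  assumes "\<And>i \<omega>. i < N \<Longrightarrow> \<omega> \<in> space M \<Longrightarrow> convex (C i \<omega>)"
  shows "convex (constraint_set M N stage C)"
proof (rule convexI)
  fix f g :: "'a \<Rightarrow> real^'b" and u v :: real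
  assume fg: "f \<in> constraint_set M N stage C" "g \<in> constraint_set M N stage C"
    and uv: "0 \<le> u" "0 \<le> v" "u + v = 1"
  have "AE \<omega> in M. block stage i ((u *\<^sub>R f + v *\<^sub>R g) \<omega>) \<in> C i \<omega>" if "i < N" for i
  proof -
    have "AE \<omega> in M. block stage i (f \<omega>) \<in> C i \<omega>" "AE \<omega> in M. block stage i (g \<omega>) \<in> C i \<omega>"
      using fg that by (auto simp: constraint_set_def)
    then show ?thesis using AE_space
    proof eventually_elim
      case (elim \<omega>)
      then show ?case using convexD[OF assms[OF that, of \<omega>] _ _ uv]
        by (simp add: linear_add[OF linear_block] linear_scale[OF linear_block])
    qed
  qed
  then show "u *\<^sub>R f + v *\<^sub>R g \<in> constraint_set M N stage C"
    using fg by (auto simp: constraint_set_def intro: L2_add L2_scaleR)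
qed

text \<open>Along an a.e. convergent subsequence the blocks converge pointwise, and the values of
  \<open>C i\<close> are closed.\<close>

lemma closed_constraint_set:
  assumes cl: "\<And>i \<omega>. i < N \<Longrightarrow> \<omega> \<in> space M \<Longrightarrow> closed (C i \<omega>)"
  shows "L2_closed M (constraint_set M N stage C)"
  unfolding L2_closed_def
proof (intro allI impI)
  fix X l
  assume X: "\<forall>n. X n \<in> constraint_set M N stage C" and l: "l \<in> L2 M"
    and lim: "(\<lambda>n::nat. L2_inner M (X n - l) (X n - l)) \<longlonglongrightarrow> 0"
  obtain r :: "nat \<Rightarrow> nat" where r: "AE \<omega> in M. (\<lambda>n. X (r n) \<omega>) \<longlonglongrightarrow> l \<omega>"
    using L2_AE_subsequence[OF _ l lim] X by (auto simp: constraint_set_def)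
  have "AE \<omega> in M. block stage i (l \<omega>) \<in> C i \<omega>" if "i < N" for i
  proof -
    have "AE \<omega> in M. \<forall>n. block stage i (X (r n) \<omega>) \<in> C i \<omega>"
      using X that by (auto simp: constraint_set_def AE_all_countable)
    then show ?thesis using r AE_space
    proof eventually_elim
      case (elim \<omega>)
      show ?case
        by (rule closed_sequentially[OF cl[OF that elim(3)] _ tendsto_block[OF elim(2)]]) (use elim(1) in simp)
    qed
  qed
  then show "l \<in> constraint_set M N stage C" using l by (simp add: constraint_set_def)
qed

lemma subspace_nonanticipative: "subspace (nonanticipative M N m \<xi> stage)"
  unfolding subspace_def
proof (intro conjI allI ballI impI)
  let ?B = "\<lambda>i. borel_measurable (info_algebra M m \<xi> i)"
  show "0 \<in> nonanticipative M N m \<xi> stage"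
    by (auto simp: nonanticipative_def L2_zero linear_0[OF linear_block] intro!: bexI[of _ "\<lambda>_. 0"])
  fix f g :: "'a \<Rightarrow> real^'b" and c :: real
  assume f: "f \<in> nonanticipative M N m \<xi> stage"
  have "\<exists>h\<in>?B i. AE \<omega> in M. block stage i ((c *\<^sub>R f) \<omega>) = h \<omega>" if i: "i < N" for i
  proof -
    obtain f' where [measurable]: "f' \<in> ?B i" and "AE \<omega> in M. block stage i (f \<omega>) = f' \<omega>"
      using f i unfolding nonanticipative_def by blast
    then show ?thesis
      by (intro bexI[of _ "\<lambda>\<omega>. c *\<^sub>R f' \<omega>"]) (auto simp: linear_scale[OF linear_block])
  qed
  then show "c *\<^sub>R f \<in> nonanticipative M N m \<xi> stage"
    using f by (auto simp: nonanticipative_def intro: L2_scaleR)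
  assume g: "g \<in> nonanticipative M N m \<xi> stage"
  have "\<exists>h\<in>?B i. AE \<omega> in M. block stage i ((f + g) \<omega>) = h \<omega>" if i: "i < N" for i
  proof -
    obtain f' g' where [measurable]: "f' \<in> ?B i" "g' \<in> ?B i"
      and "AE \<omega> in M. block stage i (f \<omega>) = f' \<omega>" "AE \<omega> in M. block stage i (g \<omega>) = g' \<omega>"
      using f g i unfolding nonanticipative_def by blast
    then show ?thesis
      by (intro bexI[of _ "\<lambda>\<omega>. f' \<omega> + g' \<omega>"]) (auto simp: linear_add[OF linear_block])
  qed
  then show "f + g \<in> nonanticipative M N m \<xi> stage"
    using f g by (auto simp: nonanticipative_def intro: L2_add)
qed

text \<open>The pointwise \<open>lim\<close> is taken of the measurable representatives instead of
  the blocks themselves. It is measurable for the stage algebra on the whole space and agrees a.e.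
  with the block of \<open>l\<close>, so the argument also covers stage 0, whose algebra is
  trivial.\<close>

lemma closed_nonanticipative:
  "L2_closed M (nonanticipative M N m \<xi> stage)"
  unfolding L2_closed_def
proof (intro allI impI)
  fix X l
  assume X: "\<forall>n. X n \<in> nonanticipative M N m \<xi> stage" and l: "l \<in> L2 M"
    and lim: "(\<lambda>n::nat. L2_inner M (X n - l) (X n - l)) \<longlonglongrightarrow> 0"
  obtain r :: "nat \<Rightarrow> nat" where r: "AE \<omega> in M. (\<lambda>n. X (r n) \<omega>) \<longlonglongrightarrow> l \<omega>"
    using L2_AE_subsequence[OF _ l lim] X by (auto simp: nonanticipative_def)
  have "\<exists>h\<in>borel_measurable (info_algebra M m \<xi> i). AE \<omega> in M. block stage i (l \<omega>) = h \<omega>" if "i < N" for i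
  proof -
    have "\<exists>h\<in>borel_measurable (info_algebra M m \<xi> i). AE \<omega> in M. block stage i (X n \<omega>) = h \<omega>" for n
      using X that by (auto simp: nonanticipative_def)
    then obtain h where h [measurable]: "\<And>n. h n \<in> borel_measurable (info_algebra M m \<xi> i)"
      and eq: "\<And>n. AE \<omega> in M. block stage i (X n \<omega>) = h n \<omega>"
      by metis
    have "AE \<omega> in M. \<forall>n. block stage i (X (r n) \<omega>) = h (r n) \<omega>"
      using eq by (simp add: AE_all_countable)
    then have "AE \<omega> in M. block stage i (l \<omega>) = lim (\<lambda>n. h (r n) \<omega>)"
      using r
    proof eventually_elim
      case (elim \<omega>)
      from tendsto_block[OF elim(2), of stage i] elim(1) have "(\<lambda>n. h (r n) \<omega>) \<longlonglongrightarrow> block stage i (l \<omega>)" by simp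
      then show ?case by (rule limI[symmetric])
    qed
    then show ?thesis by (intro bexI) (auto, measurable)
  qed
  then show "l \<in> nonanticipative M N m \<xi> stage" using l by (simp add: nonanticipative_def)
qed

text \<open>This justifies the choice in \<open>L2_proj\<close>: the abstract projection theorem is
  applied to the preimage of \<open>S\<close> under the retraction, where it provides a
  minimizer.\<close>

lemma (in prob_space) L2_proj:
  fixes S :: "('a \<Rightarrow> real^'n::finite) set" and p :: "('a \<Rightarrow> real^'n) \<Rightarrow> ('a \<Rightarrow> real^'n)"
  assumes retr: "L2_retraction M p"
    and S: "convex S" "S \<subseteq> L2 M" "S \<noteq> {}" and z: "z \<in> L2 M"
    and closed: "L2_closed M S"
  shows "L2_proj M S z \<in> S"
    and "\<And>u. u \<in> S \<Longrightarrow> L2_inner M (z - L2_proj M S z) (u - L2_proj M S z) \<le> 0"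
proof -
  note p = L2_retractionD[OF retr]
  interpret linear p by (rule p)
  define ip where "ip f g = L2_inner M (p f) (p g)" for f g
  interpret H: semi_hilbert ip unfolding ip_def by (rule semi_hilbert_L2[OF retr])
  have ip: "ip f g = L2_inner M f g" if "f \<in> L2 M" "g \<in> L2 M" for f g
    using that by (simp add: ip_def p(3))
  define S' where "S' = p -` S"
  have S': "S \<subseteq> S'" using S(2) p(3) by (auto simp: S'_def)
  have conv: "convex S'" unfolding S'_def by (rule convex_linear_vimage[OF p(1) S(1)])
  have cl: "H.closed_ip S'"
    unfolding H.closed_ip_def
  proof (intro allI impI)
    fix X l assume "\<forall>n. X n \<in> S'" "(\<lambda>n::nat. ip (X n - l) (X n - l)) \<longlonglongrightarrow> 0"
    then show "l \<in> S'"
      using closed[unfolded L2_closed_def, rule_format, of "\<lambda>n. p (X n)" "p l"] p(2)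
      by (simp add: S'_def ip_def diff)
  qed
  obtain q where q: "q \<in> S'" "\<forall>y\<in>S'. ip (z - q) (z - q) \<le> ip (z - y) (z - y)"
    using H.projection_exists[OF conv cl, of z] S(3) S' by blast
  \<comment> \<open>The abstract minimizer \<open>q\<close> may lie outside \<open>L2 M\<close>;
    \<open>p q\<close> lies in \<open>S\<close> at the same distance, as the two differ by a null
    vector.\<close>
  have eq: "ip (z - p q) (z - p q) = ip (z - q) (z - q)"
    by (simp add: ip_def diff p)
  have norm: "L2_norm M (\<lambda>\<omega>. z \<omega> - f \<omega>) = sqrt (ip (z - f) (z - f))" if "f \<in> S" for f
  proof -
    have "z - f \<in> L2 M" using that S(2) z by (intro L2_diff) auto
    then show ?thesis by (simp add: L2_norm_def ip flip: fun_diff_def[of z f])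
  qed
  have "p q \<in> S" using q(1) by (simp add: S'_def)
  then have "\<exists>f. f \<in> S \<and> (\<forall>y\<in>S. L2_norm M (\<lambda>\<omega>. z \<omega> - f \<omega>) \<le> L2_norm M (\<lambda>\<omega>. z \<omega> - y \<omega>))"
    using q(2) S' by (intro exI[of _ "p q"]) (auto simp: norm eq)
  \<comment> \<open>The choice may select a minimizer other than \<open>p q\<close>; the variational
    inequality is derived from minimality alone.\<close>
  from someI_ex[OF this, folded L2_proj_def]
  have P: "L2_proj M S z \<in> S"
    and min: "\<forall>y\<in>S. L2_norm M (\<lambda>\<omega>. z \<omega> - L2_proj M S z \<omega>) \<le> L2_norm M (\<lambda>\<omega>. z \<omega> - y \<omega>)" by blast+
  show "L2_proj M S z \<in> S" by (rule P)
  fix u assume u: "u \<in> S"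
  have "ip (z - L2_proj M S z) (u - L2_proj M S z) \<le> 0"
    using min P by (intro H.projection_variational[OF S(1) P _ u]) (simp add: norm)
  then show "L2_inner M (z - L2_proj M S z) (u - L2_proj M S z) \<le> 0"
    using P u z S(2) by (subst (asm) ip) (auto intro: L2_diff)
qed

section \<open>The iteration in vector notation and the transfer to random vectors\<close>

lemma admm_predict_eq:
  "admm_predict M C N F \<beta> r (x, y, l) =
    (let xt = L2_proj M C (x - (1 / (\<beta> * r)) *\<^sub>R (F x - l + \<beta> *\<^sub>R (x - y)));
         yt = L2_proj M N (y - (1 / \<beta>) *\<^sub>R (l - \<beta> *\<^sub>R (xt - y)))
     in (xt, yt, l - \<beta> *\<^sub>R (xt - yt)))"
  by (simp add: admm_predict_def Let_def fun_diff_def plus_fun_def scaleR_fun_def)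

lemma admm_step_eq:
  assumes "admm_predict M C N F \<beta> r (x, y, l) = (xt, yt, lt)"
  shows "admm_step M C N F \<beta> r \<alpha> (x, y, l) =
    (x - \<alpha> *\<^sub>R (x - xt - (1 / (\<beta> * r)) *\<^sub>R (F x - F xt + \<beta> *\<^sub>R (x - xt))),
     y - \<alpha> *\<^sub>R (y - yt), l - \<alpha> *\<^sub>R (l - lt))"
  unfolding admm_step_def assms Let_def
  by (simp add: admm_direction_def admm_zeta_def G_inv_def triple_diff_def triple_scale_def
      fun_diff_def plus_fun_def scaleR_fun_def)

theorem theorem3p3:
  fixes M :: "'w measure"
    and N :: nat
    and m :: "nat \<Rightarrow> nat"
    and \<xi> :: "nat \<Rightarrow> 'w \<Rightarrow> nat \<Rightarrow> real"
    and stage :: "'n::finite \<Rightarrow> nat"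
    and C :: "nat \<Rightarrow> 'w \<Rightarrow> (real^'n) set"
    and F :: "('w \<Rightarrow> real^'n) \<Rightarrow> ('w \<Rightarrow> real^'n)"
    and L_F \<beta> r \<alpha> :: real
    and \<theta> :: "nat \<Rightarrow> ('w, 'n) triple"
    and \<C> \<N> :: "('w \<Rightarrow> real^'n) set"
  defines "\<C> \<equiv> constraint_set M N stage C"
    and "\<N> \<equiv> nonanticipative M N m \<xi> stage"
  assumes "prob_space M" and "complete_measure M"
    and "N \<ge> 1"
    and "\<And>j. stage j < N"
    and "\<And>j. j \<in> {1..N - 1} \<Longrightarrow> \<xi> j \<in> measurable M (\<Pi>\<^sub>M l\<in>{..<m j}. borel)"
    and "\<And>i \<omega>. i < N \<Longrightarrow> \<omega> \<in> space M \<Longrightarrow>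
           C i \<omega> \<subseteq> block_space stage i \<and> C i \<omega> \<noteq> {} \<and> closed (C i \<omega>) \<and> convex (C i \<omega>)"
    and "\<And>i. i < N \<Longrightarrow>
           measurable_set_valued (info_algebra M m \<xi> i) (block_space stage i) (C i)"
    and "L2_operator M F"
    and "L2_monotone M F"
    and "L_F > 0" and "L2_lipschitz M L_F F"
    and "\<exists>\<theta>'. VI_solution M (T_op F) (\<C> \<times> \<N> \<times> L2 M) \<theta>'"
    and "\<beta> > 0" and "r > L_F / \<beta> + 1" and "0 < \<alpha>" and "\<alpha> < 1"
    and "\<theta> 0 \<in> \<C> \<times> \<N> \<times> L2 M"
    and "\<And>k. \<theta> (Suc k) = admm_step M \<C> \<N> F \<beta> r \<alpha> (\<theta> k)"
  shows "\<exists>x'. MSVI_solution M F (\<C> \<inter> \<N>) x' \<and> L2_weakly_converges M (\<lambda>k. fst (\<theta> k)) x'"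
proof -
  interpret prob_space M by fact
  obtain p :: "('w \<Rightarrow> real^'n) \<Rightarrow> ('w \<Rightarrow> real^'n)"
    where retr: "L2_retraction M p"
    using L2_retraction_exists by blast
  note p = L2_retractionD[OF retr]
  interpret p: linear p by (rule p)
  define ip where "ip f g = L2_inner M (p f) (p g)" for f g
  interpret H: semi_hilbert ip unfolding ip_def by (rule semi_hilbert_L2[OF retr])
  have ip: "ip f g = L2_inner M f g" if "f \<in> L2 M" "g \<in> L2 M" for f g
    using that by (simp add: ip_def p(3))
  have ip_p: "ip f (p g) = ip f g" "ip (p f) g = ip f g" for f g
    by (simp_all add: ip_def p)

  have C_L2: "\<C> \<subseteq> L2 M" and N_L2: "\<N> \<subseteq> L2 M"
    by (auto simp: \<C>_def \<N>_def constraint_set_def nonanticipative_def)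
  have clCi: "closed (C i \<omega>)" if "i < N" "\<omega> \<in> space M" for i \<omega>
    using assms(8)[OF that] by simp
  have convC: "convex \<C>" unfolding \<C>_def by (rule convex_constraint_set) (use assms(8) in blast)
  have subN: "subspace \<N>" unfolding \<N>_def by (rule subspace_nonanticipative)
  have clC: "L2_closed M \<C>" unfolding \<C>_def by (rule closed_constraint_set[OF clCi])
  have clN: "L2_closed M \<N>" unfolding \<N>_def by (rule closed_nonanticipative)
  obtain xs ys ls where vi: "VI_solution M (T_op F) (\<C> \<times> \<N> \<times> L2 M) (xs, ys, ls)"
    using assms(14) by (metis prod_cases3)
  then have s_in: "xs \<in> \<C>" "ys \<in> \<N>" "ls \<in> L2 M" by (auto simp: VI_solution_def)
  have neC: "\<C> \<noteq> {}" and neN: "\<N> \<noteq> {}" using s_in by auto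
  note projC = L2_proj[OF retr convC C_L2 neC _ clC]
    and projN = L2_proj[OF retr subspace_imp_convex[OF subN] N_L2 neN _ clN]
  have F_in: "F f \<in> L2 M" if "f \<in> L2 M" for f using assms(10) that by (simp add: L2_operator_def)

  define x y l where "x k = fst (\<theta> k)" and "y k = fst (snd (\<theta> k))" and "l k = snd (snd (\<theta> k))" for k
  have \<theta>: "\<theta> k = (x k, y k, l k)" for k by (simp add: x_def y_def l_def)
  define xt where "xt k = L2_proj M \<C> (x k - (1 / (\<beta> * r)) *\<^sub>R (F (x k) - l k + \<beta> *\<^sub>R (x k - y k)))" for k
  define yt where "yt k = L2_proj M \<N> (y k - (1 / \<beta>) *\<^sub>R (l k - \<beta> *\<^sub>R (xt k - y k)))" for k
  define lt where "lt k = l k - \<beta> *\<^sub>R (xt k - yt k)" for k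
  have "admm_predict M \<C> \<N> F \<beta> r (x k, y k, l k) = (xt k, yt k, lt k)" for k
    by (simp add: admm_predict_eq Let_def xt_def yt_def lt_def)
  from admm_step_eq[OF this] have step:
    "x (Suc k) = x k - \<alpha> *\<^sub>R (x k - xt k - (1 / (\<beta> * r)) *\<^sub>R (F (x k) - F (xt k) + \<beta> *\<^sub>R (x k - xt k)))"
    "y (Suc k) = y k - \<alpha> *\<^sub>R (y k - yt k)" "l (Suc k) = l k - \<alpha> *\<^sub>R (l k - lt k)" for k
    using assms(20)[of k] unfolding \<theta> by simp_all

  note L2_intros = L2_add L2_diff L2_scaleR F_in
  have zx: "x k - (1 / (\<beta> * r)) *\<^sub>R (F (x k) - l k + \<beta> *\<^sub>R (x k - y k)) \<in> L2 M"
    if "x k \<in> L2 M" "y k \<in> L2 M" "l k \<in> L2 M" for k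
    using that by (intro L2_intros)
  have xt_C: "xt k \<in> \<C>" if "x k \<in> L2 M" "y k \<in> L2 M" "l k \<in> L2 M" for k
    unfolding xt_def by (rule projC(1)[OF zx[OF that]])
  have zy: "y k - (1 / \<beta>) *\<^sub>R (l k - \<beta> *\<^sub>R (xt k - y k)) \<in> L2 M"
    if "x k \<in> L2 M" "y k \<in> L2 M" "l k \<in> L2 M" for k
    using that subsetD[OF C_L2 xt_C[OF that]] by (intro L2_intros)
  have yt_N: "yt k \<in> \<N>" if "x k \<in> L2 M" "y k \<in> L2 M" "l k \<in> L2 M" for k
    unfolding yt_def by (rule projN(1)[OF zy[OF that]])
  \<comment> \<open>Projection is controlled for square-integrable arguments, so membership of the
    iterates and of the predictions is carried along in one induction.\<close>
  have L2: "x k \<in> L2 M \<and> y k \<in> L2 M \<and> l k \<in> L2 M" for k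
  proof (induction k)
    case 0
    then show ?case using assms(19) C_L2 N_L2 unfolding \<theta> by auto
  next
    case (Suc k)
    then have "x k \<in> L2 M" "y k \<in> L2 M" "l k \<in> L2 M" by auto
    moreover from this have "xt k \<in> L2 M" "yt k \<in> L2 M" using xt_C yt_N C_L2 N_L2 by blast+
    moreover from calculation have "lt k \<in> L2 M" unfolding lt_def by (intro L2_intros)
    ultimately show ?case unfolding step by (intro conjI L2_intros)
  qed
  then have xL: "x k \<in> L2 M" and yL: "y k \<in> L2 M" and lL: "l k \<in> L2 M" for k by auto
  have xt_C: "xt k \<in> \<C>" and yt_N: "yt k \<in> \<N>" for k
    using xt_C yt_N xL yL lL by auto
  then have xtL: "xt k \<in> L2 M" and ytL: "yt k \<in> L2 M" for k using C_L2 N_L2 by auto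

  \<comment> \<open>The locale quantifies over all functions, while the data are controlled on
    \<open>L2 M\<close>. Preimages under \<open>p\<close> and composition with \<open>p\<close>
    extend sets and operator without changing them on \<open>L2 M\<close>.\<close>
  define C' N' F' where "C' = p -` \<C>" and "N' = p -` \<N>" and "F' f = F (p f)" for f
  have closed': "H.closed_ip (p -` S)"
    if "L2_closed M S" for S
    unfolding H.closed_ip_def
  proof (intro allI impI)
    fix X l assume "\<forall>n. X n \<in> p -` S" "(\<lambda>n::nat. ip (X n - l) (X n - l)) \<longlonglongrightarrow> 0"
    then show "l \<in> p -` S"
      using that[unfolded L2_closed_def, rule_format, of "\<lambda>n. p (X n)" "p l"] p(2)
      by (simp add: ip_def p.diff)
  qed
  interpret A: semi_hilbert_admm ip C' N' F' L_F \<beta> r \<alpha> x y l xt yt lt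
  proof
    show "convex C'" unfolding C'_def by (rule convex_linear_vimage[OF p(1) convC])
    show "H.closed_ip C'" unfolding C'_def using clC by (rule closed')
    show "subspace N'" unfolding N'_def by (rule linear_subspace_vimage[OF p(1) subN])
    show "H.closed_ip N'" unfolding N'_def using clN by (rule closed')
    show "0 < \<beta>" "L_F / \<beta> + 1 < r" "0 < \<alpha>" "\<alpha> < 1" "0 \<le> L_F" using assms by auto
    fix u v k
    have F: "F' u - F' v \<in> L2 M" "p (F' u - F' v) = F' u - F' v"
      unfolding F'_def by (auto intro!: L2_diff F_in p)
    have "0 \<le> L2_inner M (F' u - F' v) (p u - p v)"
      using assms(11) p(2) unfolding L2_monotone_def F'_def fun_diff_def by blast
    then show "0 \<le> ip (F' u - F' v) (u - v)" by (simp only: ip_def F(2) p.diff[of u v])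
    have "(L2_norm M (F' u - F' v))\<^sup>2 \<le> (L_F * L2_norm M (p u - p v))\<^sup>2"
    proof (rule power_mono)
      show "L2_norm M (F' u - F' v) \<le> L_F * L2_norm M (p u - p v)"
        using assms(13) p(2) unfolding L2_lipschitz_def F'_def fun_diff_def by blast
      show "0 \<le> L2_norm M (F' u - F' v)" by (simp add: L2_norm_def L2_inner_self)
    qed
    then show "ip (F' u - F' v) (F' u - F' v) \<le> L_F\<^sup>2 * ip (u - v) (u - v)"
      by (simp add: ip_def F(2) p.diff[of u v] L2_norm_sq power_mult_distrib)
    show "xt k \<in> C'" using xt_C xtL p(3) by (simp add: C'_def)
    show "yt k \<in> N'" using yt_N ytL p(3) by (simp add: N'_def)
    show "y 0 \<in> N'" using assms(19) yL p(3) unfolding \<theta> by (simp add: N'_def)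
    have F'_eq: "F' (x k) = F (x k)" "F' (xt k) = F (xt k)" using xL xtL p(3) by (simp_all add: F'_def)
    show "lt k = l k - \<beta> *\<^sub>R (xt k - yt k)" by (simp add: lt_def)
    show "x (Suc k) = x k - \<alpha> *\<^sub>R (x k - xt k
        - (1 / (\<beta> * r)) *\<^sub>R (F' (x k) - F' (xt k) + \<beta> *\<^sub>R (x k - xt k)))"
      unfolding F'_eq by (rule step)
    show "y (Suc k) = y k - \<alpha> *\<^sub>R (y k - yt k)" "l (Suc k) = l k - \<alpha> *\<^sub>R (l k - lt k)"
      by (rule step)+
    { assume "u \<in> C'"
      then have u: "p u \<in> \<C>" by (simp add: C'_def)
      let ?z = "x k - (1 / (\<beta> * r)) *\<^sub>R (F (x k) - l k + \<beta> *\<^sub>R (x k - y k))"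
      have "L2_inner M (?z - xt k) (p u - xt k) \<le> 0"
        unfolding xt_def by (rule projC(2)[OF zx[OF xL yL lL] u])
      moreover have "p (?z - xt k) = ?z - xt k" by (intro p L2_diff zx xL yL lL xtL)
      ultimately show "ip (x k - (1 / (\<beta> * r)) *\<^sub>R (F' (x k) - l k + \<beta> *\<^sub>R (x k - y k)) - xt k) (u - xt k) \<le> 0"
        unfolding ip_def F'_eq by (simp add: p.diff[of u] p(3)[OF xtL]) }
    { assume "v \<in> N'"
      then have v: "p v \<in> \<N>" by (simp add: N'_def)
      let ?z = "y k - (1 / \<beta>) *\<^sub>R (l k - \<beta> *\<^sub>R (xt k - y k))"
      have "L2_inner M (?z - yt k) (p v - yt k) \<le> 0"
        unfolding yt_def by (rule projN(2)[OF zy[OF xL yL lL] v])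
      moreover have "p (?z - yt k) = ?z - yt k" by (intro p L2_diff zy xL yL lL ytL)
      ultimately show "ip (y k - (1 / \<beta>) *\<^sub>R (l k - \<beta> *\<^sub>R (xt k - y k)) - yt k) (v - yt k) \<le> 0"
        unfolding ip_def by (simp add: p.diff[of v] p(3)[OF ytL]) }
  qed

  have sL: "xs \<in> L2 M" "ys \<in> L2 M" using s_in C_L2 N_L2 by auto
  \<comment> \<open>The single inequality on triples; each condition in \<open>sol\<close> follows
    by varying one component and keeping the other two at the solution.\<close>
  have VI: "0 \<le> ip (F xs - ls) (u - xs) + ip ls (v - ys) + ip (xs - ys) (w - ls)"
    if "u \<in> \<C>" "v \<in> \<N>" "w \<in> L2 M" for u v w
  proof -
    have "u \<in> L2 M" "v \<in> L2 M" using that C_L2 N_L2 by auto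
    moreover have "0 \<le> L2_inner M (F xs - ls) (u - xs) + L2_inner M ls (v - ys) + L2_inner M (xs - ys) (w - ls)"
    proof -
      have "0 \<le> triple_inner M (T_op F (xs, ys, ls)) (triple_diff (u, v, w) (xs, ys, ls))"
        using vi that unfolding VI_solution_def by blast
      then show ?thesis by (simp add: T_op_def triple_inner_def triple_diff_def fun_diff_def)
    qed
    ultimately show ?thesis using that sL s_in(3) F_in by (simp add: ip L2_diff)
  qed
  have "A.sol xs ys ls"
    unfolding A.sol_def
  proof (intro conjI ballI)
    show "xs \<in> C'" "ys \<in> N'" using s_in sL p(3) by (simp_all add: C'_def N'_def)
    \<comment> \<open>This multiplier test point turns the inequality into nonpositivity of the
      squared distance between \<open>xs\<close> and \<open>ys\<close>.\<close>
    have "0 \<le> ip (xs - ys) (- (xs - ys))"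
      using VI[OF s_in(1,2), of "ls - (xs - ys)"] s_in(3) sL by (simp add: L2_diff)
    then show "ip (xs - ys) (xs - ys) = 0"
      using H.ip_ge_0[of "xs - ys"] H.ip_minus_right[of "xs - ys" "xs - ys"] by linarith
  next
    fix v assume "v \<in> N'"
    then have v: "p v \<in> \<N>" by (simp add: N'_def)
    \<comment> \<open>Perturbing \<open>ys\<close> in both directions inside the subspace forces
      equality.\<close>
    have "ys + p v \<in> \<N>" "ys - p v \<in> \<N>" using subN s_in(2) v by (auto intro: subspace_add subspace_diff)
    from VI[OF s_in(1) this(1) s_in(3)] VI[OF s_in(1) this(2) s_in(3)]
    show "ip ls v = 0" by (simp add: ip_p)
  next
    fix u assume "u \<in> C'"
    then have "p u \<in> \<C>" by (simp add: C'_def)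
    from VI[OF this s_in(2,3)] have "0 \<le> ip (F xs - ls) (p u - xs)" by simp
    then show "0 \<le> ip (F' xs - ls) (u - xs)"
      by (simp add: F'_def p(3)[OF sL(1)] H.ip_diff_right ip_p)
  qed
  from A.weak_convergence[OF this] obtain x' where x': "x' \<in> C'" "x' \<in> N'"
    "\<And>u. u \<in> C' \<Longrightarrow> u \<in> N' \<Longrightarrow> 0 \<le> ip (F' x') (u - x')"
    "H.weak_tendsto x x' sequentially" by blast
  \<comment> \<open>The abstract limit \<open>x'\<close> is an arbitrary function;
    \<open>p x'\<close> is its square-integrable representative with the same inner
    products.\<close>
  have "MSVI_solution M F (\<C> \<inter> \<N>) (p x')"
    unfolding MSVI_solution_def L2_normal_cone_def
  proof (intro conjI CollectI ballI)
    show "p x' \<in> \<C> \<inter> \<N>" using x' by (simp add: C'_def N'_def)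
    have "- F (p x') \<in> L2 M" by (intro L2_uminus F_in p)
    then show "(\<lambda>\<omega>. - F (p x') \<omega>) \<in> L2 M" by (simp add: fun_Compl_def)
    fix u assume u: "u \<in> \<C> \<inter> \<N>"
    then have uL: "u \<in> L2 M" using C_L2 by auto
    have "0 \<le> ip (F' x') (u - x')" using x'(3)[of u] u p(3)[OF uL] by (simp add: C'_def N'_def)
    then have "0 \<le> L2_inner M (F (p x')) (u - p x')"
      by (simp add: ip_def F'_def p.diff p(3)[OF uL] p(3)[OF F_in[OF p(2)]])
    then show "L2_inner M (\<lambda>\<omega>. - F (p x') \<omega>) (\<lambda>\<omega>. u \<omega> - p x' \<omega>) \<le> 0"
      by (simp add: L2_inner_def)
  qed
  moreover have "L2_weakly_converges M (\<lambda>k. fst (\<theta> k)) (p x')"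
    unfolding L2_weakly_converges_def \<theta> fst_conv
  proof (intro conjI allI ballI)
    show "x k \<in> L2 M" for k by (rule xL)
    show "p x' \<in> L2 M" by (rule p)
    fix v :: "'w \<Rightarrow> real^'n" assume v: "v \<in> L2 M"
    have "(\<lambda>k. ip (x k) v) \<longlonglongrightarrow> ip x' v" using x'(4) by (rule H.weak_tendstoD)
    then show "(\<lambda>k. L2_inner M (x k) v) \<longlonglongrightarrow> L2_inner M (p x') v"
      by (simp add: ip_def p(3)[OF v] p(3)[OF xL])
  qed
  ultimately show ?thesis by blast
qed

end
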